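(* Let $\eta$ be the standard semicircular distribution, and let $\nu_u$ be the free Gibbs measure associated with a smooth $\epsilon$-uniformly convex potential $u:\mathbb{R}\to\mathbb{R}$, $\epsilon>0$. Let $T$ be the optimal transport map sending $\eta$ to $\nu_u$. If $T$ is $\mathcal{C}^3$, then $T$ is $\sqrt{\epsilon^{-1}}$-Lipschitz.
   Context: The standard semicircular distribution is $\eta(dx)=\frac1{2\pi}\sqrt{4-x^2}\,dx$ on $[-2,2]$. For a convex function $u:\mathbb{R}\to\mathbb{R}$, the free Gibbs measure $\nu_u$ is the unique minimizer, over Borel probability measures $\rho$ on $\mathbb{R}$, of $-\iint\log|t-s|\,d\rho(t)\,d\rho(s)+\int u(s)\,d\rho(s)$. The potential $u$ is $\epsilon$-uniformly convex if $x\mapsto u(x)-\frac{\epsilon}{2}x^2$ is convex. The optimal transport map is the Brenier map for the quadratic cost $|x-y|^2$ (the nondecreasing map with $T_\sharp\eta=\nu_u$). *)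

theory Defs
  imports "HOL-Probability.Probability"
begin

definition semicircle :: "real measure" where
  "semicircle = density lborel
     (\<lambda>x. ennreal (indicator {-2..2} x * (1 / (2 * pi) * sqrt (4 - x\<^sup>2))))"

(* Integral of a function of arbitrary sign with values in the extended reals. In ereal,
   \<infinity> - \<infinity> = \<infinity>, so an integral that is not defined takes the value \<infinity>. *)
definition ereal_integral :: "'a measure \<Rightarrow> ('a \<Rightarrow> ereal) \<Rightarrow> ereal" where
  "ereal_integral M f =
     enn2ereal (\<integral>\<^sup>+x. e2ennreal (f x) \<partial>M) - enn2ereal (\<integral>\<^sup>+x. e2ennreal (- f x) \<partial>M)"

(* - log |t - s|, with value \<infinity> on the diagonal (the library has ln 0 = 0), so that
   a measure with atoms has infinite energy. *)
definition neg_log_dist :: "real \<Rightarrow> real \<Rightarrow> ereal" where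
  "neg_log_dist t s = (if t = s then \<infinity> else ereal (- ln \<bar>t - s\<bar>))"

(* For uniformly convex u the second summand is \<infinity> whenever the first one is -\<infinity> or
   undefined: the integral of log^+ |t - s| is finite if \<rho> has a finite second moment. The
   conventions of ereal then make the energy \<infinity>, as usual for this functional. *)
definition free_energy :: "(real \<Rightarrow> real) \<Rightarrow> real measure \<Rightarrow> ereal" where
  "free_energy u \<rho> =
     ereal_integral (\<rho> \<Otimes>\<^sub>M \<rho>) (\<lambda>(t, s). neg_log_dist t s)
     + ereal_integral \<rho> (\<lambda>s. ereal (u s))"

(* The minimizer is unique for the potentials considered here; uniqueness is a consequence
   and is not built into the predicate. *)
definition free_gibbs_measure :: "(real \<Rightarrow> real) \<Rightarrow> real measure \<Rightarrow> bool" where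
  "free_gibbs_measure u \<nu> \<longleftrightarrow> is_arg_min (free_energy u) real_distribution \<nu>"

definition uniformly_convex :: "real \<Rightarrow> (real \<Rightarrow> real) \<Rightarrow> bool" where
  "uniformly_convex \<epsilon> u \<longleftrightarrow> convex_on UNIV (\<lambda>x. u x - \<epsilon> / 2 * x\<^sup>2)"

primrec Ck_on :: "nat \<Rightarrow> (real \<Rightarrow> real) \<Rightarrow> real set \<Rightarrow> bool" where
  "Ck_on 0 f S \<longleftrightarrow> continuous_on S f"
| "Ck_on (Suc k) f S \<longleftrightarrow>
     (\<exists>f'. (\<forall>x\<in>S. (f has_real_derivative f' x) (at x within S)) \<and> Ck_on k f' S)"

definition smooth :: "(real \<Rightarrow> real) \<Rightarrow> bool" where
  "smooth f \<longleftrightarrow> (\<forall>k. Ck_on k f UNIV)"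

(* The optimal map on the line for the cost |x - y|^2: the nondecreasing map that pushes \<mu>
   forward to \<nu>. It is determined only up to \<mu>-null sets, so monotonicity is required on a
   set of full measure. *)
definition brenier_map :: "real measure \<Rightarrow> real measure \<Rightarrow> (real \<Rightarrow> real) \<Rightarrow> bool" where
  "brenier_map \<mu> \<nu> T \<longleftrightarrow>
     T \<in> borel_measurable \<mu> \<and> distr \<mu> borel T = \<nu> \<and>
     (\<exists>A. (AE x in \<mu>. x \<in> A) \<and> mono_on A T)"

end

theory Submission
  imports Defs "HOL-Computational_Algebra.Formal_Power_Series" "HOL-Complex_Analysis.Great_Picard"
begin

text \<open>
The contraction is proved for finitely many charges, where it is an elementary maximum principle,
and then passed to the limit; the edges of the support and singular integrals do not appear.

Let \<open>x\<close> and \<open>y\<close> be sorted configurations of \<open>n\<close> points that minimize the discrete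
logarithmic energy for the potentials \<open>u\<close> and \<open>x\<^sup>2 / 2\<close>. Both satisfy a force balance.
Subtracting the balances at the two indices where \<open>(x j - x i) / (y j - y i)\<close> is maximal shows
that this maximum \<open>M\<close> satisfies \<open>\<epsilon> * M\<^sup>2 \<le> 1\<close> (\<open>equilibrium_spacing_le\<close>). So there is a
nondecreasing \<open>sqrt (1 / \<epsilon>)\<close>-Lipschitz map that sends \<open>y\<close> to \<open>x\<close>.

The empirical measures of \<open>y\<close> converge to the semicircle law, because the force balance yields a
recurrence for their moments that becomes the Catalan recurrence in the limit
(\<open>integral_empirical_tendsto_semicircle\<close>). By the theorem of Arzela and Ascoli the maps have
a limit \<open>S\<close>, which is again nondecreasing and \<open>sqrt (1 / \<epsilon>)\<close>-Lipschitz.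

It remains to identify \<open>S\<close> with \<open>T\<close>. The energy of the image of the semicircle law under \<open>S\<close>
is at most the limit of the discrete minimal energies (\<open>energy_limit\<close>), and these are at most
the energy of \<open>\<nu>\<close>, by sampling independent points from \<open>\<nu>\<close>
(\<open>log_energy_le_sampling\<close>). As \<open>S\<close> and \<open>T\<close> are both nondecreasing, the energy is
strictly convex along the segment between them (\<open>energy_displacement_convex\<close>); since \<open>\<nu>\<close> is
a minimizer, \<open>S = T\<close> almost everywhere, and by continuity everywhere on the open interval.
\<close>

section \<open>Uniformly convex potentials\<close>

lemma smooth_has_derivative:
  assumes "smooth u"
  obtains u' where "\<And>x. (u has_real_derivative u' x) (at x)"
proof -
  have "Ck_on (Suc 0) u UNIV" using assms unfolding smooth_def by blast
  then show ?thesis using that by auto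
qed

lemma uniformly_convex_deriv_mono:
  assumes uc: "uniformly_convex \<epsilon> u" and D: "\<And>x. (u has_real_derivative u' x) (at x)"
    and ab: "a \<le> b"
  shows "\<epsilon> * (b - a) \<le> u' b - u' a"
proof -
  let ?f = "\<lambda>x. u x - \<epsilon> / 2 * x\<^sup>2" and ?f' = "\<lambda>x. u' x - \<epsilon> * x"
  have cv: "convex_on UNIV ?f" using uc unfolding uniformly_convex_def .
  have D': "(?f has_real_derivative ?f' x) (at x)" for x
    by (auto intro!: derivative_eq_intros D)
  have 1: "?f' a * (b - a) \<le> ?f b - ?f a"
    by (rule convex_on_imp_above_tangent[OF cv]) (use D' in auto)
  have 2: "?f' b * (a - b) \<le> ?f a - ?f b"
    by (rule convex_on_imp_above_tangent[OF cv]) (use D' in auto)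
  from 1 2 have "(?f' b - ?f' a) * (b - a) \<ge> 0" by (simp add: algebra_simps)
  then have "?f' b - ?f' a \<ge> 0" using ab
    by (cases "a = b") (auto simp: zero_le_mult_iff)
  then show ?thesis by (simp add: algebra_simps)
qed

lemma uniformly_convex_above_parabola:
  assumes uc: "uniformly_convex \<epsilon> u" and D: "\<And>x. (u has_real_derivative u' x) (at x)"
  shows "u 0 + u' 0 * x + \<epsilon> / 2 * x\<^sup>2 \<le> u x"
proof -
  let ?f = "\<lambda>x. u x - \<epsilon> / 2 * x\<^sup>2" and ?f' = "\<lambda>x. u' x - \<epsilon> * x"
  have cv: "convex_on UNIV ?f" using uc unfolding uniformly_convex_def .
  have D': "(?f has_real_derivative ?f' x) (at x)" for x
    by (auto intro!: derivative_eq_intros D)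
  have "?f' 0 * (x - 0) \<le> ?f x - ?f 0"
    by (rule convex_on_imp_above_tangent[OF cv]) (use D'[of 0] in auto)
  then show ?thesis by simp
qed

text \<open>Of the slope \<open>3\<close>, two thirds pay for the interaction: as
\<open>ln \<bar>t - s\<bar> \<le> \<bar>t\<bar> + \<bar>s\<bar>\<close>, and pairs are ordered, it charges each point at most
\<open>2 * \<bar>x\<bar>\<close>. The rest makes the sublevels of the energy bounded.\<close>

lemma uniformly_convex_coercive:
  assumes "\<epsilon> > 0" and uc: "uniformly_convex \<epsilon> u" 
    and D: "\<And>x. (u has_real_derivative u' x) (at x)"
  obtains D where "D \<ge> 0" "\<And>x. 3 * \<bar>x\<bar> - D \<le> u x"
proof
  let ?D = "\<bar>u 0\<bar> + (3 + \<bar>u' 0\<bar>)\<^sup>2 / (2 * \<epsilon>)"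
  show "?D \<ge> 0" using assms(1) by simp
  fix x
  \<comment> \<open>complete the square in the parabola that supports \<open>u\<close> at the origin\<close>
  have "0 \<le> (\<epsilon> * \<bar>x\<bar> - (3 + \<bar>u' 0\<bar>))\<^sup>2 / (2 * \<epsilon>)" using assms(1) by simp
  also have "\<dots> = \<epsilon> / 2 * x\<^sup>2 - (3 + \<bar>u' 0\<bar>) * \<bar>x\<bar> + (3 + \<bar>u' 0\<bar>)\<^sup>2 / (2 * \<epsilon>)"
    using assms(1) unfolding power2_diff power_mult_distrib power2_abs 
    by (simp add: field_simps power2_eq_square)
  finally have "(3 + \<bar>u' 0\<bar>) * \<bar>x\<bar> \<le> \<epsilon> / 2 * x\<^sup>2 + (3 + \<bar>u' 0\<bar>)\<^sup>2 / (2 * \<epsilon>)" by linarith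
  moreover have "- (u' 0 * x) \<le> \<bar>u' 0\<bar> * \<bar>x\<bar>" by (simp add: abs_mult[symmetric])
  moreover have "u 0 \<ge> - \<bar>u 0\<bar>" by linarith
  ultimately show "3 * \<bar>x\<bar> - ?D \<le> u x"
    using uniformly_convex_above_parabola[OF uc D, of x] by (simp add: algebra_simps)
qed

text \<open>The gap in the midpoint inequality is what later forces two minimizing maps to agree.\<close>

lemma uniformly_convex_midpoint:
  assumes "uniformly_convex \<epsilon> u"
  shows "u ((a + b) / 2) \<le> (u a + u b) / 2 - \<epsilon> / 8 * (a - b)\<^sup>2"
proof -
  let ?f = "\<lambda>x. u x - \<epsilon> / 2 * x\<^sup>2"
  have "convex_on UNIV ?f" using assms unfolding uniformly_convex_def .
  from convex_onD[OF this, of "1/2" a b]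
  have "?f ((a + b) / 2) \<le> (?f a + ?f b) / 2" by (simp add: add_divide_distrib)
  then show ?thesis by (simp add: field_simps power2_eq_square)
qed

section \<open>Fekete points\<close>

text \<open>The energy of \<open>n\<close> charges at the positions \<open>x i\<close>, scaled by \<open>n\<^sup>2\<close>: divided by
\<open>n\<^sup>2\<close> it is the free energy of the empirical measure without its infinite diagonal part.
Minimizing configurations are the (weighted) Fekete points.\<close>

definition log_energy :: "(real \<Rightarrow> real) \<Rightarrow> nat \<Rightarrow> (nat \<Rightarrow> real) \<Rightarrow> real" where
  "log_energy u n x = (\<Sum>i<n. \<Sum>j\<in>{..<n}-{i}. - ln \<bar>x i - x j\<bar>) + real n * (\<Sum>i<n. u (x i))"

text \<open>Configurations are functions on all of \<open>nat\<close> that vanish from \<open>n\<close> on, so that one type serves every \<open>n\<close>.\<close>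

lemma compact_finite_box: "compact (PiE UNIV (\<lambda>i::nat. if i < n then {-R..R} else {0::real}))"
proof -
  have "compactin (product_topology (\<lambda>i. euclidean) UNIV) (PiE UNIV (\<lambda>i::nat. if i < n then {-R..R} else {0::real}))"
    unfolding compactin_PiE by simp
  then show ?thesis by (simp add: euclidean_product_topology)
qed

text \<open>Maximize \<open>exp (- log_energy)\<close> instead: written as a product of distances it is
continuous everywhere, vanishes at collisions and is therefore free of singularities. By
coercivity it is small outside a large box, so a maximum over the box is a global one.\<close>

lemma log_energy_minimizer_exists:
  fixes u :: "real \<Rightarrow> real"
  assumes cont: "continuous_on UNIV u" and coercive: "\<And>x. 3 * \<bar>x\<bar> - D \<le> u x" and "D \<ge> 0" and n: "n > 0"
  obtains x where "inj_on x {..<n}" "\<And>z. inj_on z {..<n} \<Longrightarrow> log_energy u n x \<le> log_energy u n z"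
proof -
  define W where "W = (\<lambda>z::nat \<Rightarrow> real. (\<Prod>i<n. \<Prod>j\<in>{..<n}-{i}. \<bar>z i - z j\<bar>) * exp (- (real n * (\<Sum>i<n. u (z i)))))"
  have W_inj: "W z = exp (- log_energy u n z)" if "inj_on z {..<n}" for z
  proof -
    have "(\<Prod>i<n. \<Prod>j\<in>{..<n}-{i}. \<bar>z i - z j\<bar>) = (\<Prod>i<n. \<Prod>j\<in>{..<n}-{i}. exp (ln \<bar>z i - z j\<bar>))"
      using that by (intro prod.cong refl exp_ln[symmetric]) (auto simp: inj_on_def)
    also have "\<dots> = exp (\<Sum>i<n. \<Sum>j\<in>{..<n}-{i}. ln \<bar>z i - z j\<bar>)"
      by (simp add: exp_sum)
    finally show ?thesis unfolding W_def log_energy_def by (simp add: exp_add[symmetric] sum_negf)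
  qed
  \<comment> \<open>one coordinate far out already makes \<open>W\<close> small, uniformly in the others\<close>
  have W_bound: "W z \<le> exp (real n * (real n * D - \<bar>z k\<bar>))" if "k < n" for z k
  proof -
    have "(\<Prod>i<n. \<Prod>j\<in>{..<n}-{i}. \<bar>z i - z j\<bar>) \<le> (\<Prod>i<n. \<Prod>j\<in>{..<n}-{i}. exp (\<bar>z i\<bar> + \<bar>z j\<bar>))"
    proof (intro prod_mono conjI prod_nonneg)
      fix i j
      have "\<bar>z i - z j\<bar> \<le> 1 + (\<bar>z i\<bar> + \<bar>z j\<bar>)" by linarith
      then show "\<bar>z i - z j\<bar> \<le> exp (\<bar>z i\<bar> + \<bar>z j\<bar>)" using exp_ge_add_one_self order_trans by blast
    qed auto
    also have "\<dots> = exp (\<Sum>i<n. \<Sum>j\<in>{..<n}-{i}. \<bar>z i\<bar> + \<bar>z j\<bar>)" by (simp add: exp_sum)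
    also have "\<dots> \<le> exp (\<Sum>i<n. \<Sum>j<n. \<bar>z i\<bar> + \<bar>z j\<bar>)"
      by (simp, intro sum_mono sum_mono2) auto
    also have "(\<Sum>i<n. \<Sum>j<n. \<bar>z i\<bar> + \<bar>z j\<bar>) = 2 * real n * (\<Sum>i<n. \<bar>z i\<bar>)"
      by (simp add: sum.distrib sum_distrib_left mult.assoc)
    finally have 1: "(\<Prod>i<n. \<Prod>j\<in>{..<n}-{i}. \<bar>z i - z j\<bar>) \<le> exp (2 * real n * (\<Sum>i<n. \<bar>z i\<bar>))" .
    have "(\<Sum>i<n. 3 * \<bar>z i\<bar> - D) \<le> (\<Sum>i<n. u (z i))" by (intro sum_mono coercive)
    then have "real n * (3 * (\<Sum>i<n. \<bar>z i\<bar>) - real n * D) \<le> real n * (\<Sum>i<n. u (z i))"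
      by (intro mult_left_mono) (simp_all add: sum_subtractf sum_distrib_left)
    moreover have "\<bar>z k\<bar> \<le> (\<Sum>i<n. \<bar>z i\<bar>)" using that by (intro member_le_sum) auto
    then have "real n * \<bar>z k\<bar> \<le> real n * (\<Sum>i<n. \<bar>z i\<bar>)" by (intro mult_left_mono) auto
    ultimately have 2: "2 * real n * (\<Sum>i<n. \<bar>z i\<bar>) - real n * (\<Sum>i<n. u (z i)) \<le> real n * (real n * D - \<bar>z k\<bar>)"
      by (simp add: algebra_simps)
    have "W z \<le> exp (2 * real n * (\<Sum>i<n. \<bar>z i\<bar>)) * exp (- (real n * (\<Sum>i<n. u (z i))))"
      unfolding W_def by (intro mult_right_mono 1) simp
    also have "\<dots> = exp (2 * real n * (\<Sum>i<n. \<bar>z i\<bar>) - real n * (\<Sum>i<n. u (z i)))"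
      by (simp add: exp_add[symmetric])
    finally show ?thesis using 2 exp_le_cancel_iff order_trans by blast
  qed
  define z0 where "z0 = (\<lambda>i. if i < n then real i else 0)"
  have z0: "inj_on z0 {..<n}" by (auto simp: inj_on_def z0_def)
  define R where "R = real n + real n * D + \<bar>log_energy u n z0\<bar> + 1"
  define K where "K = PiE UNIV (\<lambda>i::nat. if i < n then {-R..R} else {0::real})"
  have R: "R \<ge> real n" using \<open>D \<ge> 0\<close> by (simp add: R_def)
  have z0K: "z0 \<in> K" unfolding K_def z0_def using R by (auto split: if_splits)
  have contu: "continuous_on UNIV (\<lambda>z. u (z i))" for i :: nat
    by (rule continuous_on_compose2[OF cont]) auto
  have "continuous_on UNIV W" unfolding W_def
    by (intro continuous_intros contu continuous_on_product_coordinates)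
  then have "continuous_on K W" by (rule continuous_on_subset) simp
  moreover have "compact K" unfolding K_def by (rule compact_finite_box)
  moreover have "K \<noteq> {}" using z0K by blast
  ultimately obtain x where x: "x \<in> K" and max: "\<forall>z\<in>K. W z \<le> W x"
    using continuous_attains_sup by metis
  have big: "W z0 \<le> W x" using max z0K by blast
  have "W z0 > 0" by (simp add: W_inj[OF z0])
  with big have "W x \<noteq> 0" by linarith
  then have xinj: "inj_on x {..<n}" unfolding inj_on_def W_def by (auto simp: prod_zero_iff)
  show ?thesis
  proof (rule that[OF xinj])
    fix z :: "nat \<Rightarrow> real" assume z: "inj_on z {..<n}"
    define z' where "z' = (\<lambda>i. if i < n then z i else 0)"
    have "W z = W z'" unfolding W_def z'_def by (auto intro!: arg_cong2[of _ _ _ _ "(*)"] prod.cong)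
    also have "W z' \<le> W x"
    proof (cases "z' \<in> K")
      case False
      have "\<exists>k<n. \<bar>z' k\<bar> > R"
      proof (rule ccontr)
        assume "\<not> (\<exists>k<n. \<bar>z' k\<bar> > R)"
        then have "z' k \<in> {-R..R}" if "k < n" for k using that by (metis abs_le_iff atLeastAtMost_iff linorder_not_less minus_le_iff)
        then have "z' \<in> K" unfolding K_def by (auto simp: z'_def)
        with False show False ..
      qed
      then obtain k where k: "k < n" "\<bar>z' k\<bar> > R" by blast
      have t: "real n * D - \<bar>z' k\<bar> \<le> - \<bar>log_energy u n z0\<bar>" using k by (simp add: R_def)
      have "real n * (real n * D - \<bar>z' k\<bar>) \<le> 1 * (real n * D - \<bar>z' k\<bar>)"
      proof (rule mult_right_mono_neg)
        show "real n * D - \<bar>z' k\<bar> \<le> 0" using t by linarith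
      qed (use n in simp)
      also have "\<dots> \<le> - log_energy u n z0" using t by simp
      finally have "W z' \<le> exp (- log_energy u n z0)" 
        using W_bound[OF k(1), of z'] by (meson exp_le_cancel_iff order_trans)
      then show ?thesis using W_inj[OF z0] big by simp
    qed (use max in blast)
    finally show "log_energy u n x \<le> log_energy u n z" by (simp add: W_inj z xinj)
  qed
qed

text \<open>The energy only sees the set of positions, so that a minimizer may be sorted.\<close>

lemma log_energy_image:
  assumes "inj_on x {..<n}"
  shows "log_energy u n x = (\<Sum>a\<in>x ` {..<n}. \<Sum>b\<in>x ` {..<n} - {a}. - ln \<bar>a - b\<bar>) + real n * (\<Sum>a\<in>x ` {..<n}. u a)"
proof -
  have 1: "x ` {..<n} - {x i} = x ` ({..<n} - {i})" if "i < n" for i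
    using assms that by (auto simp: inj_on_def)
  have 2: "(\<Sum>b\<in>x ` {..<n} - {x i}. - ln \<bar>x i - b\<bar>) = (\<Sum>j\<in>{..<n}-{i}. - ln \<bar>x i - x j\<bar>)" if "i < n" for i
    unfolding 1[OF that] by (subst sum.reindex) (auto intro: inj_on_subset[OF assms])
  show ?thesis unfolding log_energy_def sum.reindex[OF assms] o_def
    using 2 by simp
qed

lemma log_energy_sorted_minimizer_exists:
  fixes u :: "real \<Rightarrow> real"
  assumes "continuous_on UNIV u" "\<And>x. 3 * \<bar>x\<bar> - D \<le> u x" "D \<ge> 0" "n > 0"
  obtains x where "\<And>i j. i < j \<Longrightarrow> j < n \<Longrightarrow> x i < x j"
    "\<And>z. inj_on z {..<n} \<Longrightarrow> log_energy u n x \<le> log_energy u n z"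
proof -
  obtain x where x: "inj_on x {..<n}" and min: "\<And>z. inj_on z {..<n} \<Longrightarrow> log_energy u n x \<le> log_energy u n z"
    using log_energy_minimizer_exists[OF assms] by metis
  define xs where "xs = sorted_list_of_set (x ` {..<n})"
  have xs: "sorted xs" "distinct xs" "set xs = x ` {..<n}" by (simp_all add: xs_def)
  have len: "length xs = n" unfolding xs_def by (simp add: card_image[OF x])
  have lt: "xs ! i < xs ! j" if "i < j" "j < n" for i j
    using that xs len by (metis less_imp_le_nat linorder_not_le nless_le nth_eq_iff_index_eq order.strict_trans sorted_nth_mono)
  have inj: "inj_on (\<lambda>i. xs ! i) {..<n}" using xs(2) len by (simp add: inj_on_nth)
  have img: "(\<lambda>i. xs ! i) ` {..<n} = x ` {..<n}" using xs(3) len by (auto simp: set_conv_nth)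
  have "log_energy u n (\<lambda>i. xs ! i) = log_energy u n x"
    unfolding log_energy_image[OF inj] log_energy_image[OF x] img ..
  with that[of "\<lambda>i. xs ! i"] lt min show ?thesis by simp
qed

text \<open>The energy as a function of the position \<open>t\<close> of a single charge; the first summand is constant.\<close>

lemma log_energy_upd:
  assumes "i < n"
  shows "log_energy u n (x(i := t)) =
    ((\<Sum>a\<in>{..<n}-{i}. \<Sum>b\<in>{..<n}-{a,i}. - ln \<bar>x a - x b\<bar>) + real n * (\<Sum>a\<in>{..<n}-{i}. u (x a)))
    + 2 * (\<Sum>k\<in>{..<n}-{i}. - ln \<bar>t - x k\<bar>) + real n * u t"
proof -
  let ?y = "x(i := t)" and ?I = "{..<n}-{i}"
  have row: "(\<Sum>b\<in>{..<n}-{a}. - ln \<bar>?y a - ?y b\<bar>) = - ln \<bar>t - x a\<bar> + (\<Sum>b\<in>{..<n}-{a,i}. - ln \<bar>x a - x b\<bar>)"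
    if "a \<in> ?I" for a
  proof -
    have "{..<n}-{a} = insert i ({..<n}-{a,i})" using that assms by auto
    then show ?thesis using that by (simp add: abs_minus_commute)
  qed
  have "(\<Sum>a<n. \<Sum>b\<in>{..<n}-{a}. - ln \<bar>?y a - ?y b\<bar>)
     = (\<Sum>b\<in>?I. - ln \<bar>?y i - ?y b\<bar>) + (\<Sum>a\<in>?I. \<Sum>b\<in>{..<n}-{a}. - ln \<bar>?y a - ?y b\<bar>)"
    using assms by (subst sum.remove[of _ i]) auto
  also have "(\<Sum>b\<in>?I. - ln \<bar>?y i - ?y b\<bar>) = (\<Sum>b\<in>?I. - ln \<bar>t - x b\<bar>)"
    by (intro sum.cong) auto
  also have "(\<Sum>a\<in>?I. \<Sum>b\<in>{..<n}-{a}. - ln \<bar>?y a - ?y b\<bar>)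
      = (\<Sum>a\<in>?I. - ln \<bar>t - x a\<bar>) + (\<Sum>a\<in>?I. \<Sum>b\<in>{..<n}-{a,i}. - ln \<bar>x a - x b\<bar>)"
    unfolding sum.distrib[symmetric] by (intro sum.cong refl row)
  finally have 1: "(\<Sum>a<n. \<Sum>b\<in>{..<n}-{a}. - ln \<bar>?y a - ?y b\<bar>) =
    (\<Sum>b\<in>?I. - ln \<bar>t - x b\<bar>) + ((\<Sum>a\<in>?I. - ln \<bar>t - x a\<bar>) + (\<Sum>a\<in>?I. \<Sum>b\<in>{..<n}-{a,i}. - ln \<bar>x a - x b\<bar>))" .
  have "(\<Sum>a<n. u (?y a)) = u t + (\<Sum>a\<in>?I. u (?y a))"
    using assms by (subst sum.remove[of _ i]) auto
  also have "(\<Sum>a\<in>?I. u (?y a)) = (\<Sum>a\<in>?I. u (x a))" by (intro sum.cong) auto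
  finally show ?thesis unfolding log_energy_def 1 by (simp add: algebra_simps)
qed

lemma ln_abs_has_derivative:
  fixes t :: real assumes "t \<noteq> c"
  shows "((\<lambda>t. ln \<bar>t - c\<bar>) has_real_derivative 1 / (t - c)) (at t)"
proof -
  have "ln \<bar>s - c\<bar> = ln ((s - c)\<^sup>2) / 2" for s
    using ln_realpow[of "\<bar>s - c\<bar>" 2] by (cases "s = c") simp_all
  then have "(\<lambda>t. ln \<bar>t - c\<bar>) = (\<lambda>s. ln ((s - c)\<^sup>2) / 2)" by auto
  moreover have "((\<lambda>s. ln ((s - c)\<^sup>2) / 2) has_real_derivative 1 / (t - c)) (at t)"
  proof -
    have pos: "0 < (t - c)\<^sup>2" using assms by simp
    have "((\<lambda>s. (s - c)\<^sup>2) has_real_derivative 2 * (t - c)) (at t)"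
      by (auto intro!: derivative_eq_intros)
    from DERIV_cdivide[OF DERIV_chain2[OF DERIV_ln_divide[OF pos] this], of 2]
    have "((\<lambda>s. ln ((s - c)\<^sup>2) / 2) has_real_derivative 1 / (t - c)\<^sup>2 * (2 * (t - c)) / 2) (at t)" .
    moreover have "1 / r\<^sup>2 * (2 * r) / 2 = 1 / r" for r :: real
      by (simp add: power2_eq_square)
    ultimately show ?thesis by (simp only:)
  qed
  ultimately show ?thesis by simp
qed

text \<open>Each charge sits at a local minimum of the energy in its own coordinate, which gives the force
balance.\<close>

lemma log_energy_minimizer_equilibrium:
  fixes u u' :: "real \<Rightarrow> real"
  assumes D: "\<And>x. (u has_real_derivative u' x) (at x)"
    and inj: "inj_on x {..<n}"
    and min: "\<And>z. inj_on z {..<n} \<Longrightarrow> log_energy u n x \<le> log_energy u n z"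
    and i: "i < n"
  shows "real n * u' (x i) = 2 * (\<Sum>k\<in>{..<n}-{i}. 1 / (x i - x k))"
proof -
  let ?f = "\<lambda>t. log_energy u n (x(i := t))"
  let ?l = "2 * (\<Sum>k\<in>{..<n}-{i}. - (1 / (x i - x k))) + real n * u' (x i)"
  have ne: "x i \<noteq> x k" if "k \<in> {..<n}-{i}" for k using that inj i by (auto simp: inj_on_def)
  have "(?f has_real_derivative 0 + 2 * (\<Sum>k\<in>{..<n}-{i}. - (1 / (x i - x k))) + real n * u' (x i)) (at (x i))"
    unfolding log_energy_upd[OF i]
    by (intro DERIV_add DERIV_const DERIV_cmult DERIV_sum DERIV_minus ln_abs_has_derivative D ne)
  then have der: "(?f has_real_derivative ?l) (at (x i))" by simp
  obtain d where d: "d > 0" "\<And>a. a \<in> x ` ({..<n}-{i}) \<Longrightarrow> a \<noteq> x i \<Longrightarrow> d \<le> dist (x i) a"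
    using finite_set_avoid[of "x ` ({..<n}-{i})" "x i"] by auto
  have "?f (x i) \<le> ?f t" if t: "\<bar>x i - t\<bar> < d" for t
  proof -
    have "inj_on (x(i := t)) {..<n}"
    proof -
      have "t \<notin> x ` ({..<n}-{i})"
      proof
        assume mem: "t \<in> x ` ({..<n}-{i})"
        then have "t \<noteq> x i" using ne by fastforce
        from d(2)[OF mem this] t show False by (simp add: dist_real_def)
      qed
      then show ?thesis using inj unfolding inj_on_def by auto
    qed
    from min[OF this] show ?thesis by simp
  qed
  then have "?l = 0" using DERIV_local_min[OF der d(1)] by blast
  then show ?thesis by (simp add: sum_negf)
qed

section \<open>Comparison of the gaps of two equilibria\<close>

text \<open>The contribution of a charge at distance \<open>a\<close> outside the gap \<open>M * d'\<close>, compared with that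
of a charge at distance \<open>a'\<close> outside the gap \<open>d'\<close>.\<close>

lemma reciprocal_diff_le:
  fixes a d a' d' M :: real
  assumes "0 < a" "0 < d'" "0 < a'" "0 < M" "a \<le> M * a'"
  shows "1 / (a + M * d') - 1 / a \<le> (1 / (a' + d') - 1 / a') / M"
proof -
  have pos: "0 < M * d'" "0 < a + M * d'" "0 < a' + d'" using assms by (simp_all add: add_pos_pos)
  have 1: "1 / (a + M * d') - 1 / a = - ((M * d') / (a * (a + M * d')))"
    using assms(1) pos by (simp add: field_simps)
  have 2: "(1 / (a' + d') - 1 / a') / M = - ((M * d') / ((M * a') * (M * (a' + d'))))"
  proof -
    have "1 / (a' + d') - 1 / a' = - (d' / (a' * (a' + d')))"
      using assms(3) pos by (simp add: field_simps)
    moreover have "(M * d') / ((M * a') * (M * s)) = d' / (a' * s) / M" for s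
      using assms(4) by simp
    ultimately show ?thesis by simp
  qed
  have "a * (a + M * d') \<le> (M * a') * (M * (a' + d'))"
    using assms pos by (intro mult_mono) (simp_all add: algebra_simps)
  then have "(M * d') / ((M * a') * (M * (a' + d'))) \<le> (M * d') / (a * (a + M * d'))"
    using assms pos by (intro divide_left_mono) simp_all
  then show ?thesis unfolding 1 2 by simp
qed

text \<open>A discrete maximum principle. Let \<open>M\<close> be the largest ratio of a gap of \<open>x\<close> to the
corresponding gap of \<open>y\<close>, attained at a pair \<open>p < q\<close>, and subtract the force balances
at \<open>q\<close> and \<open>p\<close>. Every other charge \<open>k\<close> contributes
\<open>1 / (x q - x k) - 1 / (x p - x k) = - (x q - x p) / ((x q - x k) * (x p - x k))\<close>, and this is
at most \<open>1 / M\<close> times the same expression for \<open>y\<close>: if \<open>k\<close> lies outside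
\<open>{p..q}\<close>, because both factors of the positive denominator are in absolute value at most
\<open>M\<close> times those of \<open>y\<close>; if it lies between, because \<open>x\<close> must then be an exact dilation of \<open>y\<close> on the
three points, by maximality. Hence the difference of \<open>u'\<close> over the gap \<open>M * d\<close>, where
\<open>d = y q - y p\<close>, is at most \<open>d / M\<close>, whereas uniform convexity makes it at least
\<open>\<epsilon> * M * d\<close>. So \<open>M\<^sup>2 \<le> 1 / \<epsilon>\<close>.\<close>

lemma equilibrium_spacing_le:
  fixes x y :: "nat \<Rightarrow> real" and u' :: "real \<Rightarrow> real"
  assumes "\<epsilon> > 0"
    and u': "\<And>a b. a \<le> b \<Longrightarrow> \<epsilon> * (b - a) \<le> u' b - u' a"
    and x: "\<And>i j. i < j \<Longrightarrow> j < n \<Longrightarrow> x i < x j"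
    and y: "\<And>i j. i < j \<Longrightarrow> j < n \<Longrightarrow> y i < y j"
    and ex: "\<And>i. i < n \<Longrightarrow> real n * u' (x i) = 2 * (\<Sum>k\<in>{..<n}-{i}. 1 / (x i - x k))"
    and ey: "\<And>i. i < n \<Longrightarrow> real n * y i = 2 * (\<Sum>k\<in>{..<n}-{i}. 1 / (y i - y k))"
    and ij: "i < j" "j < n"
  shows "x j - x i \<le> sqrt (inverse \<epsilon>) * (y j - y i)"
proof -
  define P where "P = {(i, j). i < j \<and> j < n}"
  define r where "r = (\<lambda>(i, j). (x j - x i) / (y j - y i))"
  have "P \<subseteq> {..<n} \<times> {..<n}" by (auto simp: P_def)
  then have fin: "finite P" by (rule finite_subset) simp
  have ne: "P \<noteq> {}" using ij by (auto simp: P_def)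
  define M where "M = Max (r ` P)"
  have "M \<in> r ` P" unfolding M_def using fin ne by simp
  then obtain p q where pq: "p < q" "q < n" and M: "M = (x q - x p) / (y q - y p)"
    by (auto simp: P_def r_def)
  have le: "x b - x a \<le> M * (y b - y a)" if "a < b" "b < n" for a b
  proof -
    have "r (a, b) \<le> M" unfolding M_def using fin that by (intro Max_ge) (auto simp: P_def)
    then show ?thesis using y[OF that] by (simp add: r_def divide_le_eq)
  qed
  have Mpos: "M > 0" unfolding M using x[OF pq] y[OF pq] by simp
  define d where "d = y q - y p"
  have dpos: "d > 0" using y[OF pq] by (simp add: d_def)
  have eq: "x q - x p = M * d" using dpos by (simp add: M d_def)
  have trm: "1 / (x q - x k) - 1 / (x p - x k) \<le> (1 / (y q - y k) - 1 / (y p - y k)) / M"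
    if k: "k < n" "k \<noteq> p" "k \<noteq> q" for k
  proof -
    consider "k < p" | "p < k" "k < q" | "q < k" using k by linarith
    then show ?thesis
    proof cases
      case 1
      have "p < n" using pq by simp
      have "1 / ((x p - x k) + M * d) - 1 / (x p - x k) \<le> (1 / ((y p - y k) + d) - 1 / (y p - y k)) / M"
        using x[OF 1 \<open>p < n\<close>] y[OF 1 \<open>p < n\<close>] le[OF 1 \<open>p < n\<close>] Mpos dpos
        by (intro reciprocal_diff_le) auto
      moreover have "x p - x k + M * d = x q - x k" using eq by simp
      moreover have "y p - y k + d = y q - y k" by (simp add: d_def)
      ultimately show ?thesis by simp
    next
      case 2
      have a: "x k - x p \<le> M * (y k - y p)" "x q - x k \<le> M * (y q - y k)"
        using le 2 pq by auto
      \<comment> \<open>two inequalities whose sum is an equality\<close>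
      have "(x k - x p) + (x q - x k) = M * (y k - y p) + M * (y q - y k)"
        using eq by (simp add: d_def algebra_simps)
      with a have e: "x k - x p = M * (y k - y p)" "x q - x k = M * (y q - y k)" by linarith+
      then have e': "x p - x k = M * (y p - y k)" by (simp add: algebra_simps)
      have "1 / (M * c) = 1 / c / M" for c by simp
      then show ?thesis unfolding e' e(2) by (simp only: diff_divide_distrib order_refl)
    next
      case 3
      have flip: "1 / (b - a) = - (1 / (a - b))" for a b :: real
        by (metis minus_diff_eq divide_minus_right)
      have "1 / ((x k - x q) + M * d) - 1 / (x k - x q) \<le> (1 / ((y k - y q) + d) - 1 / (y k - y q)) / M"
        using x[OF 3 k(1)] y[OF 3 k(1)] le[OF 3 k(1)] Mpos dpos
        by (intro reciprocal_diff_le) auto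
      moreover have "x k - x q + M * d = x k - x p" using eq by simp
      moreover have "y k - y q + d = y k - y p" by (simp add: d_def)
      ultimately show ?thesis
        unfolding flip[of "x q" "x k"] flip[of "x p" "x k"] flip[of "y q" "y k"] flip[of "y p" "y k"]
        by simp
    qed
  qed
  have split: "(\<Sum>k\<in>{..<n}-{q}. 1 / (z q - z k)) - (\<Sum>k\<in>{..<n}-{p}. 1 / (z p - z k))
      = 2 / (z q - z p) + (\<Sum>k\<in>{..<n}-{p,q}. 1 / (z q - z k) - 1 / (z p - z k))"
    if "z p \<noteq> z q" for z :: "nat \<Rightarrow> real"
  proof -
    let ?J = "{..<n}-{p,q}"
    have sets: "{..<n}-{q} = insert p ?J" "{..<n}-{p} = insert q ?J"
      using pq by auto
    have "(\<Sum>k\<in>{..<n}-{q}. 1 / (z q - z k)) = 1 / (z q - z p) + (\<Sum>k\<in>?J. 1 / (z q - z k))"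
      unfolding sets(1) by (subst sum.insert) auto
    moreover have "(\<Sum>k\<in>{..<n}-{p}. 1 / (z p - z k)) = 1 / (z p - z q) + (\<Sum>k\<in>?J. 1 / (z p - z k))"
      unfolding sets(2) by (subst sum.insert) auto
    moreover have "1 / (z p - z q) = - (1 / (z q - z p))"
      by (metis minus_diff_eq divide_minus_right)
    ultimately show ?thesis unfolding sum_subtractf by linarith
  qed
  have "real n * (u' (x q) - u' (x p)) = 2 * (2 / (x q - x p) + (\<Sum>k\<in>{..<n}-{p,q}. 1 / (x q - x k) - 1 / (x p - x k)))"
    using split[of x] x[OF pq] ex[of p] ex[of q] pq by (simp add: right_diff_distrib)
  also have "\<dots> \<le> 2 * (2 / (M * d) + (\<Sum>k\<in>{..<n}-{p,q}. (1 / (y q - y k) - 1 / (y p - y k)) / M))"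
    unfolding eq using trm by (intro mult_left_mono add_left_mono sum_mono) auto
  also have "\<dots> = 2 * (2 / (y q - y p) + (\<Sum>k\<in>{..<n}-{p,q}. 1 / (y q - y k) - 1 / (y p - y k))) / M"
    by (simp add: d_def sum_divide_distrib[symmetric] add_divide_distrib[symmetric] mult.commute[of M] divide_divide_eq_left[symmetric] del: divide_divide_eq_left)
  also have "\<dots> = real n * (y q - y p) / M"
    using split[of y] y[OF pq] ey[of p] ey[of q] pq by (simp add: right_diff_distrib)
  finally have "real n * (u' (x q) - u' (x p)) \<le> real n * (d / M)" by (simp add: d_def)
  then have "u' (x q) - u' (x p) \<le> d / M" by (rule mult_left_le_imp_le) (use pq in simp)
  moreover have "\<epsilon> * (M * d) \<le> u' (x q) - u' (x p)"
    using u'[of "x p" "x q"] x[OF pq] eq by simp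
  ultimately have "\<epsilon> * (M * d) \<le> d / M" by linarith
  then have "M\<^sup>2 \<le> inverse \<epsilon>" using Mpos dpos assms(1) by (simp add: field_simps power2_eq_square)
  then have "M \<le> sqrt (inverse \<epsilon>)" by (rule real_le_rsqrt)
  then have "M * (y j - y i) \<le> sqrt (inverse \<epsilon>) * (y j - y i)"
    using y[OF ij] by (intro mult_right_mono) auto
  with le[OF ij] show ?thesis by linarith
qed

section \<open>Moments of equilibria and of the semicircle law\<close>

text \<open>Multiply the force balance at \<open>y i\<close> by \<open>y i ^ k\<close>, sum over \<open>i\<close> and symmetrize the
double sum: the quotients \<open>(y i ^ k - y j ^ k) / (y i - y j)\<close> are geometric sums. The
last term corrects for the absent diagonal and vanishes as \<open>n\<close> grows.\<close>

lemma equilibrium_moment_recurrence: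
  fixes y :: "nat \<Rightarrow> real"
  assumes n: "n > 0" and inj: "inj_on y {..<n}"
    and ey: "\<And>i. i < n \<Longrightarrow> real n * y i = 2 * (\<Sum>k\<in>{..<n}-{i}. 1 / (y i - y k))"
  defines "p \<equiv> \<lambda>k. (\<Sum>i<n. y i ^ k) / real n"
  shows "p (Suc k) = (\<Sum>a<k. p a * p (k - Suc a)) - real k / real n * p (k - 1)"
proof -
  define Q where "Q = (\<lambda>i j. \<Sum>a<k. y j ^ (k - Suc a) * y i ^ a)"
  have P: "(\<Sum>i<n. y i ^ k) = real n * p k" for k using n by (simp add: p_def)
  have swap: "(\<Sum>i<n. \<Sum>j\<in>{..<n}-{i}. f i j) = (\<Sum>i<n. \<Sum>j\<in>{..<n}-{i}. f j i)" for f :: "nat \<Rightarrow> nat \<Rightarrow> real"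
  proof -
    have *: "(\<Sum>i<n. \<Sum>j\<in>{..<n}-{i}. g i j) = (\<Sum>i<n. \<Sum>j<n. if i = j then 0 else g i j)" for g :: "nat \<Rightarrow> nat \<Rightarrow> real"
      by (intro sum.cong refl sum.mono_neutral_cong_left) auto
    show ?thesis unfolding * by (subst sum.swap) (intro sum.cong refl, auto)
  qed
  have "real n * (real n * p (Suc k)) = (\<Sum>i<n. (real n * y i) * y i ^ k)"
    unfolding P[symmetric] by (simp add: sum_distrib_left mult_ac)
  also have "\<dots> = (\<Sum>i<n. 2 * (\<Sum>j\<in>{..<n}-{i}. y i ^ k / (y i - y j)))"
    by (intro sum.cong refl) (simp add: ey sum_distrib_left sum_distrib_right)
  also have "\<dots> = (\<Sum>i<n. \<Sum>j\<in>{..<n}-{i}. y i ^ k / (y i - y j)) + (\<Sum>i<n. \<Sum>j\<in>{..<n}-{i}. y j ^ k / (y j - y i))"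
    by (subst (2) swap) (simp add: sum_distrib_left sum.distrib[symmetric])
  also have "\<dots> = (\<Sum>i<n. \<Sum>j\<in>{..<n}-{i}. Q i j)"
    unfolding sum.distrib[symmetric]
  proof (intro sum.cong refl)
    fix i j assume ij: "i \<in> {..<n}" "j \<in> {..<n}-{i}"
    then have ne: "y i - y j \<noteq> 0" using inj by (auto simp: inj_on_def)
    have "y j ^ k / (y j - y i) = - (y j ^ k / (y i - y j))" by (metis minus_diff_eq divide_minus_right)
    then have "y i ^ k / (y i - y j) + y j ^ k / (y j - y i) = (y i ^ k - y j ^ k) / (y i - y j)"
      by (simp add: diff_divide_distrib)
    also have "\<dots> = Q i j" unfolding Q_def power_diff_sumr2 using ne by simp
    finally show "y i ^ k / (y i - y j) + y j ^ k / (y j - y i) = Q i j" .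
  qed
  also have "\<dots> = (\<Sum>i<n. (\<Sum>j<n. Q i j) - Q i i)"
    by (intro sum.cong refl) (simp add: sum_diff1)
  also have "\<dots> = (\<Sum>i<n. \<Sum>j<n. Q i j) - (\<Sum>i<n. Q i i)" by (simp add: sum_subtractf)
  also have "(\<Sum>i<n. \<Sum>j<n. Q i j) = (\<Sum>a<k. (\<Sum>i<n. y i ^ a) * (\<Sum>j<n. y j ^ (k - Suc a)))"
  proof -
    have "(\<Sum>i<n. \<Sum>j<n. Q i j) = (\<Sum>i<n. \<Sum>a<k. \<Sum>j<n. y j ^ (k - Suc a) * y i ^ a)"
      unfolding Q_def by (intro sum.cong refl sum.swap)
    also have "\<dots> = (\<Sum>a<k. \<Sum>i<n. \<Sum>j<n. y j ^ (k - Suc a) * y i ^ a)" by (rule sum.swap)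
    finally show ?thesis by (simp add: sum_product mult.commute)
  qed
  also have "\<dots> = real n * (real n * (\<Sum>a<k. p a * p (k - Suc a)))"
    by (simp add: P sum_distrib_left mult_ac)
  also have "(\<Sum>i<n. Q i i) = (\<Sum>i<n. real k * y i ^ (k - 1))"
  proof (intro sum.cong refl)
    fix i
    have "Q i i = (\<Sum>a<k. y i ^ (k - 1))" unfolding Q_def
      by (intro sum.cong refl) (simp add: power_add[symmetric])
    then show "Q i i = real k * y i ^ (k - 1)" by simp
  qed
  also have "\<dots> = real k * (real n * p (k - 1))" by (simp add: P sum_distrib_left[symmetric])
  finally have "real n * (real n * p (Suc k)) = real n * (real n * (\<Sum>a<k. p a * p (k - Suc a))) - real k * (real n * p (k - 1))" .
  moreover have "real k * (real n * p (k - 1)) = real n * (real n * (real k / real n * p (k - 1)))"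
    using n by simp
  ultimately have "real n * (real n * p (Suc k)) = real n * (real n * ((\<Sum>a<k. p a * p (k - Suc a)) - real k / real n * p (k - 1)))"
    by (simp only: right_diff_distrib)
  then show ?thesis using n by simp
qed

lemma semicircle_density_nonneg: "0 \<le> indicator {-2..2} x * (1 / (2 * pi) * sqrt (4 - x\<^sup>2))"
  for x :: real
proof (cases "x \<in> {-2..2}")
  case True
  then have "x\<^sup>2 \<le> 2\<^sup>2" by (intro abs_le_square_iff[THEN iffD1]) auto
  then show ?thesis by simp
qed simp

lemma continuous_semicircle_integrand:
  fixes f :: "real \<Rightarrow> real"
  assumes "continuous_on {-2..2} f"
  shows "continuous_on {-2..2} (\<lambda>x. 1 / (2 * pi) * sqrt (4 - x\<^sup>2) * f x)"
  by (intro continuous_intros assms)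

lemma integrable_semicircle:
  fixes f :: "real \<Rightarrow> real"
  assumes "continuous_on {-2..2} f" and [measurable]: "f \<in> borel_measurable borel"
  shows "integrable semicircle f" and
   "integral\<^sup>L semicircle f = integral {-2..2} (\<lambda>x. 1 / (2 * pi) * sqrt (4 - x\<^sup>2) * f x)"
proof -
  let ?g = "\<lambda>x. 1 / (2 * pi) * sqrt (4 - x\<^sup>2) * f x"
  have int: "set_integrable lborel {-2..2} ?g"
    by (intro borel_integrable_atLeastAtMost' continuous_semicircle_integrand assms)
  have e: "(\<lambda>x. indicator {-2..2} x *\<^sub>R ?g x) = (\<lambda>x. (indicator {-2..2} x * (1 / (2 * pi) * sqrt (4 - x\<^sup>2))) *\<^sub>R f x)"
    by auto
  have [measurable]: "(\<lambda>x::real. indicator {-2..2} x * (1 / (2 * pi) * sqrt (4 - x\<^sup>2)) :: real) \<in> borel_measurable lborel"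
    by measurable
  have nonneg: "AE x in lborel. 0 \<le> indicator {-2..2} x * (1 / (2 * pi) * sqrt (4 - x\<^sup>2))"
    by (intro AE_I2 semicircle_density_nonneg)
  have f: "f \<in> borel_measurable lborel" by simp
  have w: "(\<lambda>x::real. indicator {-2..2} x * (1 / (2 * pi) * sqrt (4 - x\<^sup>2)) :: real) \<in> borel_measurable lborel" by measurable
  show "integrable semicircle f" 
    using int unfolding semicircle_def set_integrable_def e integrable_density[OF f w nonneg] .
  have "integral\<^sup>L semicircle f = (LINT x:{-2..2}|lborel. ?g x)"
    unfolding semicircle_def set_lebesgue_integral_def e by (rule integral_density[OF f w nonneg])
  also have "\<dots> = integral {-2..2} ?g" by (rule set_borel_integral_eq_integral(2)[OF int])
  finally show "integral\<^sup>L semicircle f = integral {-2..2} ?g" .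
qed

lemma sets_semicircle[simp, measurable_cong]: "sets semicircle = sets borel"
  by (simp add: semicircle_def)

lemma space_semicircle[simp]: "space semicircle = UNIV"
  by (simp add: semicircle_def)

lemma semicircle_mass: "((\<lambda>x. 1 / (2 * pi) * sqrt (4 - x\<^sup>2)) has_integral 1) {-2..2::real}"
proof -
  let ?F = "\<lambda>x::real. 1 / (2 * pi) * (x / 2 * sqrt (4 - x\<^sup>2) + 2 * arcsin (x / 2))"
  have "((\<lambda>x. 1 / (2 * pi) * sqrt (4 - x\<^sup>2)) has_integral (?F 2 - ?F (-2))) {-2..2::real}"
  proof (rule fundamental_theorem_of_calculus_interior)
    show "continuous_on {-2..2} ?F" by (intro continuous_intros) auto
    fix x :: real assume x: "x \<in> {-2<..<2}"
    then have "(2 - x) * (2 + x) > 0" by (intro mult_pos_pos) auto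
    then have pos: "4 - x\<^sup>2 > 0" by (simp add: algebra_simps power2_eq_square)
    have s: "sqrt (1 - (x / 2)\<^sup>2) = sqrt (4 - x\<^sup>2) / 2"
    proof -
      have "4 - x\<^sup>2 = 4 * (1 - (x / 2)\<^sup>2)" by (simp add: power_divide)
      then have "sqrt (4 - x\<^sup>2) = sqrt 4 * sqrt (1 - (x / 2)\<^sup>2)" by (simp only: real_sqrt_mult)
      then show ?thesis by simp
    qed
    define q where "q = sqrt (4 - x\<^sup>2)"
    have q: "q > 0" "q * q = 4 - x\<^sup>2" using pos by (simp_all add: q_def)
    have dx: "((\<lambda>x. x / 2) has_real_derivative 1 / 2) (at x)" by (auto intro!: derivative_eq_intros)
    have dq: "((\<lambda>x. sqrt (4 - x\<^sup>2)) has_real_derivative - (x / q)) (at x)"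
      unfolding q_def using x pos by (auto intro!: derivative_eq_intros simp: field_simps)
    have da: "((\<lambda>x. arcsin (x / 2)) has_real_derivative inverse (sqrt (1 - (x / 2)\<^sup>2)) * (1 / 2)) (at x)"
      by (rule DERIV_chain2[OF DERIV_arcsin dx]) (use x in auto)
    have "(?F has_real_derivative 1 / (2 * pi) * (1 / 2 * q + - (x / q) * (x / 2) + 2 * (inverse (q / 2) * (1 / 2)))) (at x)"
      using DERIV_cmult[OF DERIV_add[OF DERIV_mult[OF dx dq] DERIV_cmult[OF da]], of "1 / (2 * pi)" 2]
      unfolding s q_def[symmetric] .
    also have "1 / 2 * q + - (x / q) * (x / 2) + 2 * (inverse (q / 2) * (1 / 2)) = q"
      using q by (simp add: field_simps power2_eq_square)
    also have "q = sqrt (4 - x\<^sup>2)" by (simp add: q_def)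
    finally show "(?F has_vector_derivative 1 / (2 * pi) * sqrt (4 - x\<^sup>2)) (at x)"
      by (simp add: has_real_derivative_iff_has_vector_derivative)
  qed simp
  then show ?thesis by (simp add: field_simps)
qed

lemma real_distribution_semicircle: "real_distribution semicircle"
proof -
  have "integral\<^sup>L semicircle (\<lambda>_. 1::real) = 1"
    using integrable_semicircle(2)[of "\<lambda>_. 1"] integral_unique[OF semicircle_mass]
    by (simp only: mult_1_right continuous_on_const borel_measurable_const simp_thms)
  then have m: "measure semicircle UNIV = 1" by simp
  then have "emeasure semicircle UNIV \<noteq> \<infinity>" by (auto simp: measure_def)
  then have "emeasure semicircle UNIV = 1" using m by (simp add: emeasure_eq_ennreal_measure)
  then interpret prob_space semicircle by (intro prob_spaceI) simp
  show ?thesis by unfold_locales simp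
qed

lemma AE_semicircle: "AE x in semicircle. x \<in> {-2<..<2}"
proof -
  have "AE x in lborel. x \<noteq> (2::real)" "AE x in lborel. x \<noteq> (-2::real)" by (auto intro: AE_lborel_singleton)
  then have "AE x in lborel. 0 < ennreal (indicator {-2..2} x * (1 / (2 * pi) * sqrt (4 - x\<^sup>2))) \<longrightarrow> x \<in> {-2<..<2}"
    by eventually_elim (auto simp: indicator_def split: if_splits)
  then show ?thesis unfolding semicircle_def by (subst AE_density) auto
qed

definition semicircle_moment :: "nat \<Rightarrow> real" where
  "semicircle_moment k = integral\<^sup>L semicircle (\<lambda>x. x ^ k)"

lemma semicircle_moment_0: "semicircle_moment 0 = 1"
  using integrable_semicircle(2)[of "\<lambda>_. 1"] integral_unique[OF semicircle_mass]
  unfolding semicircle_moment_def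
  by (simp only: power_0 mult_1_right continuous_on_const borel_measurable_const simp_thms)

text \<open>Integrate the derivative of \<open>x ^ k * (4 - x\<^sup>2) powr (3 / 2)\<close>, which vanishes at
both ends. For \<open>k = 0\<close> the truncated subtraction is harmless, since the right-hand side is \<open>0\<close>.\<close>

lemma semicircle_moment_linear_recurrence:
  "real (k + 3) * semicircle_moment (Suc k) = 4 * real k * semicircle_moment (k - 1)"
proof -
  let ?w = "\<lambda>x::real. 1 / (2 * pi) * sqrt (4 - x\<^sup>2)"
  let ?F = "\<lambda>x::real. 1 / (2 * pi) * (x ^ k * sqrt (4 - x\<^sup>2) ^ 3)"
  have "((\<lambda>x. ?w x * (4 * real k * x ^ (k - 1) - real (k + 3) * x ^ Suc k)) has_integral (?F 2 - ?F (-2))) {-2..2::real}"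
  proof (rule fundamental_theorem_of_calculus_interior)
    show "continuous_on {-2..2} ?F" by (intro continuous_intros)
    fix x :: real assume x: "x \<in> {-2<..<2}"
    then have "(2 - x) * (2 + x) > 0" by (intro mult_pos_pos) auto
    then have pos: "4 - x\<^sup>2 > 0" by (simp add: algebra_simps power2_eq_square)
    define s where "s = sqrt (4 - x\<^sup>2)"
    have s: "s > 0" "s\<^sup>2 = 4 - x\<^sup>2" using pos by (simp_all add: s_def)
    define q where "q = (\<lambda>x::real. sqrt (4 - x\<^sup>2))"
    have qx: "q x = s" by (simp add: q_def s_def)
    have "(q has_real_derivative - (x / s)) (at x)"
      unfolding q_def s_def using x pos by (auto intro!: derivative_eq_intros simp: field_simps)
    from DERIV_cmult[OF DERIV_mult[OF DERIV_pow[of k x] DERIV_power[OF this, of 3]], of "1 / (2 * pi)"]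
    have "((\<lambda>x. 1 / (2 * pi) * (x ^ k * q x ^ 3)) has_real_derivative
        1 / (2 * pi) * (real k * x ^ (k - 1) * s ^ 3 + 3 * (s\<^sup>2 * (- (x / s))) * x ^ k)) (at x)"
      by (simp add: qx algebra_simps)
    also have "real k * x ^ (k - 1) * s ^ 3 + 3 * (s\<^sup>2 * (- (x / s))) * x ^ k
       = s * (real k * x ^ (k - 1) * s\<^sup>2 - 3 * x ^ Suc k)"
      using s(1) by (simp add: field_simps power2_eq_square power3_eq_cube)
    also have "\<dots> = s * (4 * real k * x ^ (k - 1) - real (k + 3) * x ^ Suc k)"
      unfolding s(2) by (cases k) (simp_all add: algebra_simps power2_eq_square)
    finally show "(?F has_vector_derivative ?w x * (4 * real k * x ^ (k - 1) - real (k + 3) * x ^ Suc k)) (at x)"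
      by (simp add: has_real_derivative_iff_has_vector_derivative q_def s_def mult.assoc)
  qed simp
  note FTC = this
  have "integral\<^sup>L semicircle (\<lambda>x. 4 * real k * x ^ (k - 1) - real (k + 3) * x ^ Suc k)
      = integral {-2..2} (\<lambda>x. ?w x * (4 * real k * x ^ (k - 1) - real (k + 3) * x ^ Suc k))"
    by (rule integrable_semicircle(2)) (auto intro!: continuous_intros)
  also have "\<dots> = ?F 2 - ?F (-2)" by (rule integral_unique[OF FTC])
  also have "\<dots> = 0" by simp
  finally have "integral\<^sup>L semicircle (\<lambda>x. 4 * real k * x ^ (k - 1) - real (k + 3) * x ^ Suc k) = 0" .
  moreover have int: "integrable semicircle (\<lambda>x. x ^ j)" for j
    by (rule integrable_semicircle) (auto intro!: continuous_intros)
  have "integral\<^sup>L semicircle (\<lambda>x. 4 * real k * x ^ (k - 1) - real (k + 3) * x ^ Suc k)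
      = 4 * real k * semicircle_moment (k - 1) - real (k + 3) * semicircle_moment (Suc k)"
    unfolding semicircle_moment_def
    by (subst Bochner_Integration.integral_diff) (auto simp del: power_Suc intro: int)
  ultimately show ?thesis by simp
qed

text \<open>The operator \<open>(1 - 4 X\<^sup>2) d/dX\<close> on coefficients: an equation with it is a two-step recurrence.\<close>

lemma fps_ode_nth:
  fixes G :: "real fps"
  shows "fps_nth ((1 - 4 * fps_X^2) * fps_deriv G) j =
    real (Suc j) * fps_nth G (Suc j) - (if j < 2 then 0 else 4 * real (j - 1) * fps_nth G (j - 1))"
proof -
  have "(1 - 4 * fps_X^2) * fps_deriv G = fps_deriv G - fps_const 4 * (fps_X^2 * fps_deriv G)"
    by (simp add: left_diff_distrib numeral_fps_const mult.assoc)
  moreover have "Suc (j - 2) = j - 1" if "\<not> j < 2" using that by simp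
  ultimately show ?thesis by (simp add: fps_X_power_mult_nth)
qed

text \<open>The convolution recurrence of the (aerated) Catalan numbers. The generating function \<open>f\<close>
should satisfy \<open>f = 1 + X\<^sup>2 f\<^sup>2\<close>, that is, \<open>H = 1 - 2 X\<^sup>2 f\<close> should be
a square root of \<open>1 - 4 X\<^sup>2\<close>. The linear recurrence is a linear differential equation
for \<open>H\<close>; the one that it implies for \<open>H\<^sup>2\<close> determines all coefficients.\<close>

lemma semicircle_moment_recurrence:
  "semicircle_moment (Suc k) = (\<Sum>a<k. semicircle_moment a * semicircle_moment (k - Suc a))"
proof -
  let ?c = semicircle_moment
  define f where "f = Abs_fps ?c"
  define H where "H = 1 - 2 * fps_X^2 * f"
  have H_Suc2: "fps_nth H (Suc (Suc m)) = - 2 * ?c m" for m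
    by (simp add: H_def f_def mult.assoc fps_X_power_mult_nth numeral_fps_const)
  have H0: "fps_nth H 0 = 1" "fps_nth H (Suc 0) = 0"
    by (simp_all add: H_def f_def mult.assoc fps_X_power_mult_nth numeral_fps_const)
  have c1: "?c (Suc 0) = 0" using semicircle_moment_linear_recurrence[of 0] by simp
  have H2: "fps_nth H 2 = - 2" using H_Suc2[of 0] by (simp add: semicircle_moment_0 numeral_2_eq_2)
  have H3: "fps_nth H 3 = 0" using H_Suc2[of 1] c1 by (simp add: numeral_3_eq_3)
  have ode: "(1 - 4 * fps_X^2) * fps_deriv H = fps_const (-4) * (fps_X * H)"
  proof (rule fps_ext)
    fix j
    consider "j = 0" | "j = 1" | "j = 2" | m where "j = Suc (Suc (Suc m))"
      by (cases j; cases "j - 1"; cases "j - 2") auto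
    then show "fps_nth ((1 - 4 * fps_X^2) * fps_deriv H) j = fps_nth (fps_const (-4) * (fps_X * H)) j"
    proof cases
      case 4
      show ?thesis unfolding fps_ode_nth 4
        using semicircle_moment_linear_recurrence[of "Suc m"] by (simp add: H_Suc2 algebra_simps)
    qed (simp_all add: fps_ode_nth H0 H2 H3 flip: numeral_2_eq_2 numeral_3_eq_3)
  qed
  have ode2: "(1 - 4 * fps_X^2) * fps_deriv (H^2) = fps_const (-8) * (fps_X * H^2)"
  proof -
    have "(1 - 4 * fps_X^2) * fps_deriv (H^2) = 2 * (H * ((1 - 4 * fps_X^2) * fps_deriv H))"
      by (simp add: power2_eq_square algebra_simps)
    also have "\<dots> = (fps_const 2 * fps_const (-4)) * (fps_X * H^2)"
      unfolding ode numeral_fps_const[symmetric] by (simp only: power2_eq_square mult_ac)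
    finally show ?thesis by (simp add: fps_const_mult)
  qed
  \<comment> \<open>the equation leaves \<open>d 0\<close>, \<open>d 2\<close> and nothing else: its factor \<open>j - 1\<close> stops the recurrence at \<open>d 4\<close>\<close>
  define d where "d = fps_nth (H^2)"
  have d: "real (Suc j) * d (Suc j) - (if j < 2 then 0 else 4 * real (j - 1) * d (j - 1)) = - 8 * (if j = 0 then 0 else d (j - 1))" for j
    using arg_cong[OF ode2, of "\<lambda>g. fps_nth g j"] unfolding fps_ode_nth d_def by (simp only: fps_mult_left_const_nth fps_X_mult_nth)
  have d0: "d 0 = 1" by (simp add: d_def fps_power_zeroth H0)
  have d1: "d 1 = 0" using d[of 0] by simp
  have d2: "d 2 = - 4" using d[of 1] d0 by (simp add: numeral_2_eq_2)
  have d3: "d (j + 3) = 0" for j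
  proof (induction j rule: less_induct)
    case (less j)
    have "real (j + 3) * d (j + 3) = 4 * ((real j - 1) * d (j + 1))"
      using d[of "j + 2"] by (simp add: numeral_3_eq_3 algebra_simps)
    moreover have "(real j - 1) * d (j + 1) = 0"
    proof -
      consider "j = 0" | "j = 1" | "j \<ge> 2" by linarith
      then show ?thesis
      proof cases
        case 3
        then have "d ((j - 2) + 3) = 0" by (intro less) simp
        moreover have "(j - 2) + 3 = j + 1" using 3 by simp
        ultimately show ?thesis by simp
      qed (use d1 in auto)
    qed
    ultimately have "real (j + 3) * d (j + 3) = 0" by (simp only: mult_zero_right)
    then show ?case unfolding mult_eq_0_iff of_nat_eq_0_iff by simp
  qed
  have "H^2 = 1 - fps_const 4 * fps_X^2"
  proof (rule fps_ext)
    fix j :: nat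
    consider "j = 0" | "j = 1" | "j = 2" | "j \<ge> 3" by linarith
    then show "fps_nth (H^2) j = fps_nth (1 - fps_const 4 * fps_X^2) j"
    proof cases
      case 4
      then have "d j = 0" using d3[of "j - 3"] by simp
      then show ?thesis using 4 by (simp add: d_def)
    qed (use d0 d1 d2 in \<open>simp_all add: d_def\<close>)
  qed
  then have "(1 - 4 * fps_X^2) - (1 - 2 * fps_X^2 * f)^2 = 0"
    unfolding H_def by (simp only: numeral_fps_const) simp
  moreover have "(1 - 4 * a) - (1 - 2 * a * f)^2 = 4 * (a * (f - (1 + a * f^2)))" for a :: "real fps"
    by (simp add: power2_eq_square algebra_simps)
  ultimately have "4 * (fps_X^2 * (f - (1 + fps_X^2 * f^2))) = 0" by metis
  then have f: "f = 1 + fps_X^2 * f^2"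
    by simp
  show ?thesis
  proof (cases k)
    case 0
    then show ?thesis using c1 by simp
  next
    case (Suc m)
    have "?c (Suc k) = fps_nth f (Suc (Suc m))" by (simp add: f_def Suc)
    also have "\<dots> = fps_nth (f^2) m" by (subst f) (simp add: fps_X_power_mult_nth)
    also have "\<dots> = (\<Sum>a=0..m. ?c a * ?c (m - a))" by (simp add: power2_eq_square fps_mult_nth f_def)
    also have "\<dots> = (\<Sum>a<k. ?c a * ?c (k - Suc a))" by (simp add: Suc atLeast0AtMost lessThan_Suc_atMost)
    finally show ?thesis .
  qed
qed

section \<open>Convergence to the semicircle law\<close>

text \<open>The crude bound that places the equilibrium points of the quadratic potential in the support of
the semicircle law.\<close>

lemma semicircle_moment_le: "semicircle_moment k \<le> 2 ^ k"
proof -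
  interpret real_distribution semicircle by (rule real_distribution_semicircle)
  have "integral\<^sup>L semicircle (\<lambda>x. x ^ k) \<le> integral\<^sup>L semicircle (\<lambda>x. 2 ^ k)"
  proof (rule integral_mono_AE)
    show "integrable semicircle (\<lambda>x. x ^ k)"
      by (rule integrable_semicircle) (auto intro!: continuous_intros)
    show "AE x in semicircle. x ^ k \<le> 2 ^ k"
      using AE_semicircle
    proof eventually_elim
      case (elim x)
      then have "\<bar>x\<bar> ^ k \<le> 2 ^ k" by (intro power_mono) auto
      then show ?case using abs_ge_self[of "x ^ k"] by (simp add: power_abs)
    qed
  qed simp
  then show ?thesis by (simp add: semicircle_moment_def prob_space[simplified])
qed

text \<open>Force balance in the potential \<open>x\<^sup>2 / 2\<close>. (The solutions are rescaled zeros of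
Hermite polynomials, but only the moment recurrence is used.)\<close>

locale quadratic_equilibrium =
  fixes n :: nat and y :: "nat \<Rightarrow> real"
  assumes n_pos: "n > 0" and inj: "inj_on y {..<n}"
    and equilibrium: "\<And>i. i < n \<Longrightarrow> real n * y i = 2 * (\<Sum>k\<in>{..<n}-{i}. 1 / (y i - y k))"
begin

definition moment :: "nat \<Rightarrow> real" where "moment k = (\<Sum>i<n. y i ^ k) / real n"

lemma moment_recurrence: "moment (Suc k) = (\<Sum>a<k. moment a * moment (k - Suc a)) - real k / real n * moment (k - 1)"
  unfolding moment_def by (rule equilibrium_moment_recurrence[OF n_pos inj equilibrium])

lemma moment_odd: "odd k \<Longrightarrow> moment k = 0"
proof (induction k rule: less_induct)
  case (less k)
  then obtain m where m: "k = Suc m" "even m" by (cases k) auto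
  have prod: "moment a * moment (m - Suc a) = 0" if "a < m" for a
  proof (cases "odd a")
    case True
    then show ?thesis using less.IH[of a] that m by simp
  next
    case False
    then have "odd (m - Suc a)" using that m by simp
    then show ?thesis using less.IH[of "m - Suc a"] that m by simp
  qed
  have last: "real m * moment (m - 1) = 0"
  proof (cases "m = 0")
    case False
    then have "odd (m - 1)" using m by simp
    then show ?thesis using less.IH[of "m - 1"] m False by simp
  qed simp
  have "(\<Sum>a<m. moment a * moment (m - Suc a)) = 0" by (intro sum.neutral ballI prod) simp
  with last show ?case unfolding m moment_recurrence by simp
qed

lemma moment_nonneg: "moment k \<ge> 0"
proof (cases "even k")
  case True
  then show ?thesis unfolding moment_def by (intro divide_nonneg_nonneg sum_nonneg) (auto simp: zero_le_even_power)
qed (simp add: moment_odd)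

text \<open>Without the correction term, which is nonpositive, the recurrence is that of the semicircle law;
as all moments are nonnegative, induction compares the two.\<close>

lemma moment_le: "moment k \<le> semicircle_moment k"
proof (induction k rule: less_induct)
  case (less k)
  show ?case
  proof (cases k)
    case 0
    then show ?thesis using n_pos by (simp add: moment_def semicircle_moment_0)
  next
    case (Suc m)
    have "moment k \<le> (\<Sum>a<m. moment a * moment (m - Suc a))"
      unfolding Suc moment_recurrence using moment_nonneg by simp
    also have "\<dots> \<le> (\<Sum>a<m. semicircle_moment a * semicircle_moment (m - Suc a))"
    proof (intro sum_mono mult_mono)
      fix a assume "a \<in> {..<m}"
      then show "moment a \<le> semicircle_moment a" "moment (m - Suc a) \<le> semicircle_moment (m - Suc a)"
        using Suc by (auto intro!: less.IH)
      then show "0 \<le> semicircle_moment a" using moment_nonneg order_trans by blast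
    qed (rule moment_nonneg)
    finally show ?thesis unfolding Suc semicircle_moment_recurrence .
  qed
qed

text \<open>A point outside \<open>{-2..2}\<close> would make the high moments larger than the bound allows.\<close>

lemma abs_position_le_2:
  assumes "i < n"
  shows "\<bar>y i\<bar> \<le> 2"
proof (rule ccontr)
  assume "\<not> ?thesis"
  then have "2\<^sup>2 < \<bar>y i\<bar>\<^sup>2" by (intro power_strict_mono) auto
  then have gt: "1 < (y i)\<^sup>2 / 4" by simp
  obtain j where j: "real n < ((y i)\<^sup>2 / 4) ^ j" using real_arch_pow[OF gt] by blast
  have "y i ^ (2 * j) \<le> (\<Sum>i<n. y i ^ (2 * j))"
    using assms by (intro member_le_sum) (auto simp: zero_le_even_power)
  also have "\<dots> = real n * moment (2 * j)" using n_pos by (simp add: moment_def)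
  also have "\<dots> \<le> real n * 2 ^ (2 * j)"
    using moment_le[of "2 * j"] semicircle_moment_le[of "2 * j"] by (intro mult_left_mono) auto
  finally have "((y i)\<^sup>2) ^ j \<le> real n * 4 ^ j" by (simp add: power_mult)
  then have "((y i)\<^sup>2 / 4) ^ j \<le> real n" by (simp add: power_divide divide_le_eq)
  with j show False by simp
qed

end

lemma equilibrium_moments_tendsto:
  assumes "\<And>n. quadratic_equilibrium (Suc n) (y n)"
  shows "(\<lambda>n. quadratic_equilibrium.moment (Suc n) (y n) k) \<longlonglongrightarrow> semicircle_moment k"
proof (induction k rule: less_induct)
  case (less k)
  interpret quadratic_equilibrium "Suc n" "y n" for n by (rule assms)
  show ?case
  proof (cases k)
    case 0
    then show ?thesis by (simp add: moment_def semicircle_moment_0)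
  next
    case (Suc m)
    have "(\<lambda>n. (\<Sum>a<m. moment n a * moment n (m - Suc a)) - real m / real (Suc n) * moment n (m - 1))
      \<longlonglongrightarrow> (\<Sum>a<m. semicircle_moment a * semicircle_moment (m - Suc a)) - 0 * semicircle_moment (m - 1)"
      using Suc by (intro tendsto_intros less.IH LIMSEQ_Suc[OF lim_const_over_n]) auto
    then show ?thesis unfolding Suc moment_recurrence semicircle_moment_recurrence by simp
  qed
qed

definition empirical :: "nat \<Rightarrow> (nat \<Rightarrow> real) \<Rightarrow> real measure" where
  "empirical n y = distr (measure_pmf (pmf_of_set {..<n})) borel y"

lemma real_distribution_empirical: "real_distribution (empirical n y)"
  unfolding empirical_def by (intro prob_space.real_distribution_distr measure_pmf.prob_space_axioms) simp

lemma integral_empirical: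
  assumes "n > 0" and [measurable]: "f \<in> borel_measurable borel"
  shows "integral\<^sup>L (empirical n y) f = (\<Sum>i<n. f (y i)) / real n"
proof -
  have "{..<n} \<noteq> {}" using assms(1) by auto
  then show ?thesis unfolding empirical_def
    by (subst integral_distr) (auto simp: integral_pmf_of_set)
qed

text \<open>Method of moments: all measures live on \<open>{-2..2}\<close>, where polynomials are dense.\<close>

lemma integral_empirical_tendsto_semicircle:
  fixes f :: "real \<Rightarrow> real"
  assumes "continuous_on UNIV f" and  y: "\<And>n. quadratic_equilibrium (Suc n) (y n)"
  shows "(\<lambda>n. integral\<^sup>L (empirical (Suc n) (y n)) f) \<longlonglongrightarrow> integral\<^sup>L semicircle f"
proof (rule LIMSEQ_I)
  fix e :: real assume e: "e > 0"
  interpret quadratic_equilibrium "Suc n" "y n" for n by (rule y)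
  interpret real_distribution semicircle by (rule real_distribution_semicircle)
  have f: "f \<in> borel_measurable borel" "continuous_on {-2..2} f"
    using assms(1) by (auto intro: borel_measurable_continuous_onI continuous_on_subset)
  obtain g where g: "real_polynomial_function g" "\<And>x. x \<in> {-2..2} \<Longrightarrow> \<bar>f x - g x\<bar> < e / 3"
    using Stone_Weierstrass_real_polynomial_function[of "{-2..2}" f "e / 3"] f(2) e by auto
  obtain a N where ga: "g = (\<lambda>x. \<Sum>i\<le>N. a i * x ^ i)"
    using g(1) unfolding real_polynomial_function_iff_sum by blast
  have gm: "g \<in> borel_measurable borel" unfolding ga by measurable
  have emp_g: "integral\<^sup>L (empirical (Suc n) (y n)) g = (\<Sum>k\<le>N. a k * moment n k)" for n
    unfolding integral_empirical[OF zero_less_Suc gm] moment_def unfolding ga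
    by (subst sum.swap) (simp add: sum_distrib_left sum_divide_distrib del: sum.lessThan_Suc of_nat_Suc)
  have int: "integrable semicircle (\<lambda>x. x ^ j)" for j
    by (rule integrable_semicircle) (auto intro!: continuous_intros)
  have sc_g: "integral\<^sup>L semicircle g = (\<Sum>k\<le>N. a k * semicircle_moment k)"
    unfolding ga semicircle_moment_def by (subst Bochner_Integration.integral_sum) (auto intro: int)
  have "(\<lambda>n. integral\<^sup>L (empirical (Suc n) (y n)) g) \<longlonglongrightarrow> integral\<^sup>L semicircle g"
    unfolding emp_g sc_g by (intro tendsto_intros equilibrium_moments_tendsto y)
  from LIMSEQ_D[OF this, of "e / 3"] e
  obtain n0 where n0: "\<And>n. n \<ge> n0 \<Longrightarrow> \<bar>integral\<^sup>L (empirical (Suc n) (y n)) g - integral\<^sup>L semicircle g\<bar> < e / 3"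
    by (auto simp: real_norm_def)
  have 1: "\<bar>integral\<^sup>L semicircle f - integral\<^sup>L semicircle g\<bar> \<le> e / 3"
  proof -
    have if': "integrable semicircle f" "integrable semicircle g"
      using f gm by (auto intro!: integrable_semicircle simp: ga intro!: continuous_intros)
    have "\<bar>integral\<^sup>L semicircle f - integral\<^sup>L semicircle g\<bar> = \<bar>integral\<^sup>L semicircle (\<lambda>x. f x - g x)\<bar>"
      using if' by simp
    also have "\<dots> \<le> integral\<^sup>L semicircle (\<lambda>x. \<bar>f x - g x\<bar>)" by (rule integral_abs_bound)
    also have "\<dots> \<le> integral\<^sup>L semicircle (\<lambda>x. e / 3)"
    proof (rule integral_mono_AE)
      show "AE x in semicircle. \<bar>f x - g x\<bar> \<le> e / 3"
        using AE_semicircle by eventually_elim (use g(2) in \<open>force intro: less_imp_le\<close>)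
    qed (use if' in auto)
    finally show ?thesis by (simp add: prob_space[simplified])
  qed
  have 2: "\<bar>integral\<^sup>L (empirical (Suc n) (y n)) f - integral\<^sup>L (empirical (Suc n) (y n)) g\<bar> \<le> e / 3" for n
  proof -
    have "\<bar>integral\<^sup>L (empirical (Suc n) (y n)) f - integral\<^sup>L (empirical (Suc n) (y n)) g\<bar>
       = \<bar>\<Sum>i<Suc n. f (y n i) - g (y n i)\<bar> / real (Suc n)"
      unfolding integral_empirical[OF zero_less_Suc gm] integral_empirical[OF zero_less_Suc f(1)]
      by (simp only: sum_subtractf diff_divide_distrib[symmetric] abs_divide abs_of_nat)
    also have "\<dots> \<le> (\<Sum>i<Suc n. \<bar>f (y n i) - g (y n i)\<bar>) / real (Suc n)"
      by (intro divide_right_mono sum_abs) simp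
    also have "\<dots> \<le> (\<Sum>i<Suc n. e / 3) / real (Suc n)"
    proof (intro divide_right_mono sum_mono less_imp_le g(2))
      fix i assume "i \<in> {..<Suc n}"
      then show "y n i \<in> {-2..2}" using abs_position_le_2[of i n] by (simp add: abs_le_iff)
    qed simp
    also have "\<dots> = e / 3" by (simp del: sum.lessThan_Suc of_nat_Suc)
    finally show ?thesis .
  qed
  show "\<exists>n0. \<forall>n\<ge>n0. norm (integral\<^sup>L (empirical (Suc n) (y n)) f - integral\<^sup>L semicircle f) < e"
  proof (intro exI[of _ n0] allI impI)
    fix n assume "n \<ge> n0"
    from n0[OF this] 1 2[of n] show "norm (integral\<^sup>L (empirical (Suc n) (y n)) f - integral\<^sup>L semicircle f) < e"
      unfolding real_norm_def by linarith
  qed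
qed

section \<open>Measures of finite energy\<close>

text \<open>Finite energy in terms of Bochner integrals, so that no computation with infinite values is
needed afterwards. The diagonal must be excluded explicitly, since \<open>ln 0 = 0\<close>.\<close>

definition finite_energy :: "(real \<Rightarrow> real) \<Rightarrow> real measure \<Rightarrow> bool" where
  "finite_energy u \<rho> \<longleftrightarrow> integrable \<rho> u \<and> (AE z in \<rho> \<Otimes>\<^sub>M \<rho>. fst z \<noteq> snd z) \<and>
     integrable (\<rho> \<Otimes>\<^sub>M \<rho>) (\<lambda>z. ln \<bar>fst z - snd z\<bar>)"

definition real_energy :: "(real \<Rightarrow> real) \<Rightarrow> real measure \<Rightarrow> real" where
  "real_energy u \<rho> = (\<integral>s. u s \<partial>\<rho>) - (\<integral>z. ln \<bar>fst z - snd z\<bar> \<partial>(\<rho> \<Otimes>\<^sub>M \<rho>))"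

lemma distr_pair_coordinates:
  assumes "prob_space M"
  shows "distr (M \<Otimes>\<^sub>M M) M fst = M" "distr (M \<Otimes>\<^sub>M M) M snd = M"
proof -
  interpret prob_space M by fact
  interpret P: pair_prob_space M M ..
  show fst: "distr (M \<Otimes>\<^sub>M M) M fst = M" by (rule distr_pair_fst)
  have "M = distr (distr (M \<Otimes>\<^sub>M M) (M \<Otimes>\<^sub>M M) (\<lambda>(x, y). (y, x))) M fst"
    unfolding P.distr_pair_swap[symmetric] fst ..
  also have "\<dots> = distr (M \<Otimes>\<^sub>M M) M (fst \<circ> (\<lambda>(x, y). (y, x)))"
    by (rule distr_distr) measurable
  also have "fst \<circ> (\<lambda>(x, y). (y, x)) = (snd :: 'a \<times> 'a \<Rightarrow> 'a)" by auto
  finally show "distr (M \<Otimes>\<^sub>M M) M snd = M" by simp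
qed

lemma integrable_pair_coordinates:
  fixes f :: "'a \<Rightarrow> real"
  assumes "prob_space M" "integrable M f"
  shows "integrable (M \<Otimes>\<^sub>M M) (\<lambda>z. f (fst z))" "integrable (M \<Otimes>\<^sub>M M) (\<lambda>z. f (snd z))"
  by (rule integrable_distr[OF measurable_fst] integrable_distr[OF measurable_snd],
      simp only: distr_pair_coordinates[OF assms(1)] assms(2))+

lemma AE_pair_coordinates:
  assumes "prob_space M" "AE x in M. Q x"
  shows "AE z in M \<Otimes>\<^sub>M M. Q (fst z)" "AE z in M \<Otimes>\<^sub>M M. Q (snd z)"
  by (rule AE_distrD[OF measurable_fst] AE_distrD[OF measurable_snd],
      simp only: distr_pair_coordinates[OF assms(1)] assms(2))+

lemma ereal_integral_eq_integral:
  assumes "integrable M h" "AE x in M. f x = ereal (h x)"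
  shows "ereal_integral M f = ereal (integral\<^sup>L M h)"
proof -
  have "(\<integral>\<^sup>+x. e2ennreal (f x) \<partial>M) = (\<integral>\<^sup>+x. ennreal (h x) \<partial>M)"
    by (rule nn_integral_cong_AE) (use assms(2) in eventually_elim, simp)
  moreover have "(\<integral>\<^sup>+x. e2ennreal (- f x) \<partial>M) = (\<integral>\<^sup>+x. ennreal (- h x) \<partial>M)"
    by (rule nn_integral_cong_AE) (use assms(2) in eventually_elim, simp)
  moreover obtain r where "0 \<le> r" "(\<integral>\<^sup>+x. ennreal (h x) \<partial>M) = ennreal r"
    using assms(1) unfolding real_integrable_def by (metis ennreal_cases infinity_ennreal_def)
  moreover obtain q where "0 \<le> q" "(\<integral>\<^sup>+x. ennreal (- h x) \<partial>M) = ennreal q"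
    using assms(1) unfolding real_integrable_def by (metis ennreal_cases infinity_ennreal_def)
  ultimately show ?thesis
    unfolding ereal_integral_def real_lebesgue_integral_def[OF assms(1)] by (simp add: enn2ereal_ennreal)
qed

text \<open>With the convention \<open>\<infinity> - \<infinity> = \<infinity>\<close>, a value other than \<open>\<infinity>\<close>
bounds the positive part.\<close>

lemma ereal_integral_less_PInf:
  assumes "ereal_integral M f \<noteq> \<infinity>"
  shows "(\<integral>\<^sup>+x. e2ennreal (f x) \<partial>M) < \<infinity>"
proof (rule ccontr)
  assume "\<not> ?thesis"
  then have "(\<integral>\<^sup>+x. e2ennreal (f x) \<partial>M) = \<infinity>" by (metis infinity_ennreal_def less_top)
  with assms show False by (simp add: ereal_integral_def)
qed

lemma free_energy_eq_real_energy:
  assumes "finite_energy u \<rho>"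
  shows "free_energy u \<rho> = ereal (real_energy u \<rho>)"
proof -
  have "ereal_integral \<rho> (\<lambda>s. ereal (u s)) = ereal (\<integral>s. u s \<partial>\<rho>)"
    using assms by (intro ereal_integral_eq_integral) (auto simp: finite_energy_def)
  moreover have "ereal_integral (\<rho> \<Otimes>\<^sub>M \<rho>) (\<lambda>(t, s). neg_log_dist t s) = ereal (\<integral>z. - ln \<bar>fst z - snd z\<bar> \<partial>(\<rho> \<Otimes>\<^sub>M \<rho>))"
  proof (rule ereal_integral_eq_integral)
    show "AE z in \<rho> \<Otimes>\<^sub>M \<rho>. (case z of (t, s) \<Rightarrow> neg_log_dist t s) = ereal (- ln \<bar>fst z - snd z\<bar>)"
      using assms unfolding finite_energy_def by (auto simp: neg_log_dist_def split_beta elim: AE_mp)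
  qed (use assms in \<open>simp add: finite_energy_def\<close>)
  ultimately show ?thesis unfolding free_energy_def real_energy_def by simp
qed

lemma ln_le_abs_sum: "ln \<bar>t - s\<bar> \<le> \<bar>t\<bar> + \<bar>s\<bar>" for t s :: real
proof (cases "t = s")
  case False
  then have "ln \<bar>t - s\<bar> \<le> \<bar>t - s\<bar> - 1" by (intro ln_le_minus_one) simp
  then show ?thesis by linarith
qed simp

text \<open>Finiteness of the potential energy gives a first moment, which dominates the positive part of the
logarithm; the negative part is controlled by the energy itself.\<close>

lemma finite_energy_if_free_energy_finite:
  assumes "real_distribution \<rho>" and [measurable]: "u \<in> borel_measurable borel"
    and coercive: "\<And>x. 3 * \<bar>x\<bar> - D \<le> u x"
    and fin: "free_energy u \<rho> \<noteq> \<infinity>"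
  shows "finite_energy u \<rho>"
proof -
  interpret real_distribution \<rho> by fact
  interpret P: pair_prob_space \<rho> \<rho> ..
  have b1: "ereal_integral (\<rho> \<Otimes>\<^sub>M \<rho>) (\<lambda>(t, s). neg_log_dist t s) \<noteq> \<infinity>"
    and b2: "ereal_integral \<rho> (\<lambda>s. ereal (u s)) \<noteq> \<infinity>"
    using fin unfolding free_energy_def by auto
  have [measurable]: "u \<in> borel_measurable \<rho>" by simp
  have nu: "(\<integral>\<^sup>+x. ennreal (u x) \<partial>\<rho>) < \<infinity>" using ereal_integral_less_PInf[OF b2] by simp
  have iu: "integrable \<rho> u"
  proof (rule integrableI_bounded)
    have "(\<integral>\<^sup>+x. ennreal (norm (u x)) \<partial>\<rho>) \<le> (\<integral>\<^sup>+x. (ennreal (u x) + ennreal \<bar>D\<bar>) \<partial>\<rho>)"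
    proof (rule nn_integral_mono)
      fix x
      have "norm (u x) \<le> max 0 (u x) + \<bar>D\<bar>" using coercive[of x] by auto
      then have "ennreal (norm (u x)) \<le> ennreal (max 0 (u x) + \<bar>D\<bar>)" by (rule ennreal_leI)
      then show "ennreal (norm (u x)) \<le> ennreal (u x) + ennreal \<bar>D\<bar>"
        by (simp add: ennreal_plus max_def ennreal_neg split: if_splits)
    qed
    also have "\<dots> = (\<integral>\<^sup>+x. ennreal (u x) \<partial>\<rho>) + ennreal \<bar>D\<bar>"
      using emeasure_space_1 by (subst nn_integral_add) auto
    also have "\<dots> < \<infinity>" using nu by (simp add: ennreal_add_less_top)
    finally show "(\<integral>\<^sup>+x. ennreal (norm (u x)) \<partial>\<rho>) < \<infinity>" .
  qed simp
  have ix: "integrable \<rho> (\<lambda>x. x)"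
  proof (rule Bochner_Integration.integrable_bound)
    show "integrable \<rho> (\<lambda>x. u x + D)" using iu by simp
    show "AE x in \<rho>. norm x \<le> norm (u x + D)"
    proof (rule AE_I2)
      fix x
      have "norm x \<le> 3 * \<bar>x\<bar>" by simp
      also have "\<dots> \<le> u x + D" using coercive[of x] by simp
      finally show "norm x \<le> norm (u x + D)" by simp
    qed
  qed simp
  let ?n = "\<lambda>z. neg_log_dist (fst z) (snd z)"
  have [measurable]: "?n \<in> borel_measurable (\<rho> \<Otimes>\<^sub>M \<rho>)" unfolding neg_log_dist_def by measurable
  have nl: "(\<integral>\<^sup>+z. e2ennreal (?n z) \<partial>(\<rho> \<Otimes>\<^sub>M \<rho>)) < \<infinity>"
    using ereal_integral_less_PInf[OF b1] by (simp add: split_beta)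
  have "AE z in \<rho> \<Otimes>\<^sub>M \<rho>. e2ennreal (?n z) \<noteq> \<infinity>"
    by (rule nn_integral_PInf_AE) (use nl in auto)
  then have off: "AE z in \<rho> \<Otimes>\<^sub>M \<rho>. fst z \<noteq> snd z"
    by eventually_elim (auto simp: neg_log_dist_def)
  have i1: "integrable (\<rho> \<Otimes>\<^sub>M \<rho>) (\<lambda>z. \<bar>fst z\<bar> + \<bar>snd z\<bar>)"
    using integrable_pair_coordinates[OF prob_space_axioms integrable_abs[OF ix]] by (intro Bochner_Integration.integrable_add)
  have "integrable (\<rho> \<Otimes>\<^sub>M \<rho>) (\<lambda>z. ln \<bar>fst z - snd z\<bar>)"
  proof (rule integrableI_bounded)
    have "(\<integral>\<^sup>+z. ennreal (norm (ln \<bar>fst z - snd z\<bar>)) \<partial>(\<rho> \<Otimes>\<^sub>M \<rho>))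
      \<le> (\<integral>\<^sup>+z. (e2ennreal (?n z) + ennreal (\<bar>fst z\<bar> + \<bar>snd z\<bar>)) \<partial>(\<rho> \<Otimes>\<^sub>M \<rho>))"
    proof (rule nn_integral_mono)
      fix z :: "real \<times> real"
      have "norm (ln \<bar>fst z - snd z\<bar>) \<le> max 0 (- ln \<bar>fst z - snd z\<bar>) + (\<bar>fst z\<bar> + \<bar>snd z\<bar>)"
        using ln_le_abs_sum[of "fst z" "snd z"] by auto
      then have "ennreal (norm (ln \<bar>fst z - snd z\<bar>)) \<le> ennreal (max 0 (- ln \<bar>fst z - snd z\<bar>) + (\<bar>fst z\<bar> + \<bar>snd z\<bar>))"
        by (rule ennreal_leI)
      also have "\<dots> = ennreal (max 0 (- ln \<bar>fst z - snd z\<bar>)) + ennreal (\<bar>fst z\<bar> + \<bar>snd z\<bar>)"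
        by (rule ennreal_plus) auto
      also have "ennreal (max 0 (- ln \<bar>fst z - snd z\<bar>)) = ennreal (- ln \<bar>fst z - snd z\<bar>)"
        by (simp add: max_def ennreal_neg)
      also have "\<dots> \<le> e2ennreal (?n z)" by (simp add: neg_log_dist_def)
      finally show "ennreal (norm (ln \<bar>fst z - snd z\<bar>)) \<le> e2ennreal (?n z) + ennreal (\<bar>fst z\<bar> + \<bar>snd z\<bar>)"
        by (simp add: add_right_mono)
    qed
    also have "\<dots> = (\<integral>\<^sup>+z. e2ennreal (?n z) \<partial>(\<rho> \<Otimes>\<^sub>M \<rho>)) + (\<integral>\<^sup>+z. ennreal (\<bar>fst z\<bar> + \<bar>snd z\<bar>) \<partial>(\<rho> \<Otimes>\<^sub>M \<rho>))"
      by (rule nn_integral_add) auto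
    also have "\<dots> < \<infinity>" using nl i1 unfolding real_integrable_def by (simp add: ennreal_add_less_top less_top)
    finally show "(\<integral>\<^sup>+z. ennreal (norm (ln \<bar>fst z - snd z\<bar>)) \<partial>(\<rho> \<Otimes>\<^sub>M \<rho>)) < \<infinity>" .
  qed measurable
  with iu off show ?thesis unfolding finite_energy_def by simp
qed

lemma finite_energy_distr:
  assumes "prob_space M" and [measurable]: "R \<in> borel_measurable M" "u \<in> borel_measurable borel"
  shows "finite_energy u (distr M borel R) \<longleftrightarrow> integrable M (\<lambda>x. u (R x)) \<and>
      (AE z in M \<Otimes>\<^sub>M M. R (fst z) \<noteq> R (snd z)) \<and> integrable (M \<Otimes>\<^sub>M M) (\<lambda>z. ln \<bar>R (fst z) - R (snd z)\<bar>)"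
    and "real_energy u (distr M borel R) = (\<integral>x. u (R x) \<partial>M) - (\<integral>z. ln \<bar>R (fst z) - R (snd z)\<bar> \<partial>(M \<Otimes>\<^sub>M M))"
proof -
  interpret prob_space M by fact
  interpret R: prob_space "distr M borel R" by (rule prob_space_distr) simp
  have D: "distr M borel R \<Otimes>\<^sub>M distr M borel R = distr (M \<Otimes>\<^sub>M M) (borel \<Otimes>\<^sub>M borel) (\<lambda>(x, y). (R x, R y))"
    by (rule pair_measure_distr) (auto intro: R.sigma_finite_measure_axioms)
  show "finite_energy u (distr M borel R) \<longleftrightarrow> integrable M (\<lambda>x. u (R x)) \<and>
      (AE z in M \<Otimes>\<^sub>M M. R (fst z) \<noteq> R (snd z)) \<and> integrable (M \<Otimes>\<^sub>M M) (\<lambda>z. ln \<bar>R (fst z) - R (snd z)\<bar>)"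
    unfolding finite_energy_def D
    by (subst integrable_distr_eq AE_distr_iff; (simp add: split_beta' | measurable))+
  show "real_energy u (distr M borel R) = (\<integral>x. u (R x) \<partial>M) - (\<integral>z. ln \<bar>R (fst z) - R (snd z)\<bar> \<partial>(M \<Otimes>\<^sub>M M))"
    unfolding real_energy_def D by (simp add: integral_distr split_beta')
qed

section \<open>Lower semicontinuity of the energy\<close>

lemma double_integral_tendsto:
  fixes X :: "nat \<Rightarrow> 'a \<Rightarrow> real" and g :: "real \<Rightarrow> real"
  assumes "prob_space M" and [measurable]: "\<And>k. X k \<in> borel_measurable M" "X' \<in> borel_measurable M"
    and lim: "\<And>w. w \<in> space M \<Longrightarrow> (\<lambda>k. X k w) \<longlonglongrightarrow> X' w"
    and bd: "\<And>k w. w \<in> space M \<Longrightarrow> \<bar>X k w\<bar> \<le> B"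
    and g: "continuous_on UNIV g"
  shows "(\<lambda>k. \<integral>v. \<integral>w. g (X k v - X k w) \<partial>M \<partial>M) \<longlonglongrightarrow> (\<integral>v. \<integral>w. g (X' v - X' w) \<partial>M \<partial>M)"
proof -
  interpret prob_space M by fact
  have [measurable]: "g \<in> borel_measurable borel" by (rule borel_measurable_continuous_onI[OF g])
  have "bounded (g ` {-(2*B)..2*B})"
    by (intro compact_imp_bounded compact_continuous_image continuous_on_subset[OF g]) auto
  then obtain C where C: "\<And>d. d \<in> {-(2*B)..2*B} \<Longrightarrow> \<bar>g d\<bar> \<le> C"
    unfolding bounded_iff by (metis imageI real_norm_def)
  have gC: "\<bar>g (X k v - X k w)\<bar> \<le> C" if "v \<in> space M" "w \<in> space M" for k v w
    using bd[OF that(1), of k] bd[OF that(2), of k] by (intro C) auto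
  have gl: "(\<lambda>k. g (X k v - X k w)) \<longlonglongrightarrow> g (X' v - X' w)" if "v \<in> space M" "w \<in> space M" for v w
    using g by (intro isCont_tendsto_compose[of _ g] tendsto_diff lim that) (simp add: continuous_on_eq_continuous_at)
  have inner: "(\<lambda>k. \<integral>w. g (X k v - X k w) \<partial>M) \<longlonglongrightarrow> (\<integral>w. g (X' v - X' w) \<partial>M)" if v: "v \<in> space M" for v
    by (rule integral_dominated_convergence[where w = "\<lambda>_. C"]) (use v gl gC in auto)
  show ?thesis
  proof (rule integral_dominated_convergence[where w = "\<lambda>_. C"])
    show "AE v in M. norm (\<integral>w. g (X k v - X k w) \<partial>M) \<le> C" for k
    proof (rule AE_I2)
      fix v assume v: "v \<in> space M"
      have "norm (\<integral>w. g (X k v - X k w) \<partial>M) \<le> (\<integral>w. norm (g (X k v - X k w)) \<partial>M)"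
        by (rule integral_norm_bound)
      also have "\<dots> \<le> (\<integral>w. C \<partial>M)"
      proof (rule integral_mono)
        show "integrable M (\<lambda>w. norm (g (X k v - X k w)))"
          by (rule integrable_const_bound[where B = C]) (use v gC in auto)
      qed (use v gC in auto)
      finally show "norm (\<integral>w. g (X k v - X k w) \<partial>M) \<le> C" by (simp add: prob_space)
    qed
    show "AE v in M. (\<lambda>k. \<integral>w. g (X k v - X k w) \<partial>M) \<longlonglongrightarrow> (\<integral>w. g (X' v - X' w) \<partial>M)"
      using inner by (intro AE_I2)
  qed auto
qed

text \<open>The kernel \<open>- ln \<bar>d\<bar>\<close> cut off at height \<open>K\<close>, and continuous.\<close>

definition truncated_log :: "real \<Rightarrow> real \<Rightarrow> real" where
  "truncated_log K d = - ln (max (\<bar>d\<bar>) (exp (- K)))"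

lemma max_exp_pos: "0 < max (\<bar>d\<bar>) (exp (- K))" for d K :: real
  by (simp add: less_max_iff_disj)

lemma continuous_truncated_log: "continuous_on UNIV (truncated_log K)"
  unfolding truncated_log_def using max_exp_pos by (intro continuous_intros) (auto simp: less_imp_neq[symmetric])

lemma truncated_log_le: "truncated_log K d \<le> K"
proof -
  have "ln (exp (- K)) \<le> ln (max (\<bar>d\<bar>) (exp (- K)))" using max_exp_pos by (subst ln_le_cancel_iff) auto
  then show ?thesis by (simp add: truncated_log_def)
qed

lemma truncated_log_0: "truncated_log K 0 = K"
  by (simp add: truncated_log_def max_def)

lemma truncated_log_le_neg_ln: "d \<noteq> 0 \<Longrightarrow> truncated_log K d \<le> - ln \<bar>d\<bar>"
  unfolding truncated_log_def by simp

lemma truncated_log_ge: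
  assumes "\<bar>d\<bar> \<le> B" "K \<ge> 0"
  shows "- ln (B + 1) \<le> truncated_log K d"
proof -
  have "exp (- K) \<le> 1" using assms by simp
  moreover have "0 \<le> B" using assms(1) by linarith
  ultimately have "exp (- K) \<le> B + 1" by linarith
  then have "ln (max (\<bar>d\<bar>) (exp (- K))) \<le> ln (B + 1)" using max_exp_pos[of d K] assms by (subst ln_le_cancel_iff) auto
  then show ?thesis by (simp add: truncated_log_def)
qed

lemma truncated_log_mono: "K \<le> K' \<Longrightarrow> truncated_log K d \<le> truncated_log K' d"
proof -
  assume "K \<le> K'"
  then have "max (\<bar>d\<bar>) (exp (- K')) \<le> max (\<bar>d\<bar>) (exp (- K))" by (intro max.mono) auto
  then show ?thesis using max_exp_pos[of d K] max_exp_pos[of d K'] by (simp add: truncated_log_def)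
qed

lemma truncated_log_tendsto: 
  assumes "d \<noteq> 0" shows "(\<lambda>K::nat. truncated_log (real K) d) \<longlonglongrightarrow> - ln \<bar>d\<bar>"
proof (rule tendsto_eventually)
  have "eventually (\<lambda>K::nat. - ln \<bar>d\<bar> \<le> real K) sequentially"
    by (metis eventually_sequentially nat_ceiling_le_eq real_nat_ceiling_ge order_trans of_nat_le_iff)
  then show "eventually (\<lambda>K::nat. truncated_log (real K) d = - ln \<bar>d\<bar>) sequentially"
  proof eventually_elim
    case (elim K)
    then have "exp (- real K) \<le> exp (ln \<bar>d\<bar>)" by (subst exp_le_cancel_iff) linarith
    then show ?case using assms by (simp add: truncated_log_def max_def)
  qed
qed

text \<open>A uniform bound on the truncated energies: at height \<open>K\<close> the diagonal costs \<open>K\<close> times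
its mass, so it is a null set, and monotone convergence gives the energy itself.\<close>

lemma truncation_limit:
  fixes R :: "'a \<Rightarrow> real"
  assumes "prob_space M" and [measurable]: "R \<in> borel_measurable M"
    and bd: "\<And>w. w \<in> space M \<Longrightarrow> \<bar>R w\<bar> \<le> B"
    and le: "\<And>K::nat. (\<integral>v. \<integral>w. truncated_log (real K) (R v - R w) \<partial>M \<partial>M) \<le> L"
  shows "AE z in M \<Otimes>\<^sub>M M. R (fst z) \<noteq> R (snd z)"
    and "integrable (M \<Otimes>\<^sub>M M) (\<lambda>z. ln \<bar>R (fst z) - R (snd z)\<bar>)"
    and "- (\<integral>z. ln \<bar>R (fst z) - R (snd z)\<bar> \<partial>(M \<Otimes>\<^sub>M M)) \<le> L"
proof -
  interpret prob_space M by fact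
  interpret P: pair_prob_space M M ..
  let ?f = "\<lambda>K z. truncated_log (real K) (R (fst z) - R (snd z))"
  have [measurable]: "truncated_log K \<in> borel_measurable borel" for K
    by (rule borel_measurable_continuous_onI[OF continuous_truncated_log])
  have diff: "\<bar>R (fst z) - R (snd z)\<bar> \<le> 2 * B" if "z \<in> space (M \<Otimes>\<^sub>M M)" for z
    using bd[of "fst z"] bd[of "snd z"] that by (auto simp: space_pair_measure)
  define C where "C = ln (2 * B + 1)"
  obtain w where "w \<in> space M" using not_empty by blast
  from bd[OF this] have "B \<ge> 0" by linarith
  then have C0: "C \<ge> 0" unfolding C_def by (intro ln_ge_zero) simp
  have ge: "- C \<le> ?f K z" if "z \<in> space (M \<Otimes>\<^sub>M M)" for K z
    unfolding C_def by (intro truncated_log_ge diff that) simp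
  have int: "integrable (M \<Otimes>\<^sub>M M) (?f K)" for K
  proof (rule P.P.integrable_const_bound[where B = "real K + \<bar>C\<bar>"])
    show "AE z in M \<Otimes>\<^sub>M M. norm (?f K z) \<le> real K + \<bar>C\<bar>"
    proof (rule AE_I2)
      fix z assume "z \<in> space (M \<Otimes>\<^sub>M M)"
      from ge[OF this, of K] truncated_log_le[of "real K" "R (fst z) - R (snd z)"]
      show "norm (?f K z) \<le> real K + \<bar>C\<bar>" by auto
    qed
  qed measurable
  have le': "integral\<^sup>L (M \<Otimes>\<^sub>M M) (?f K) \<le> L" for K
    using le[of K] P.integral_fst'[OF int[of K]] by simp
  define Z where "Z = {z \<in> space (M \<Otimes>\<^sub>M M). R (fst z) = R (snd z)}"
  have [measurable]: "Z \<in> sets (M \<Otimes>\<^sub>M M)" unfolding Z_def by measurable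
  have "measure (M \<Otimes>\<^sub>M M) Z \<le> 0"
  proof (rule ccontr)
    assume "\<not> ?thesis"
    then have pos: "measure (M \<Otimes>\<^sub>M M) Z > 0" by simp
    \<comment> \<open>a height at which the diagonal alone would exceed the bound\<close>
    obtain K :: nat where K: "(L + C) / measure (M \<Otimes>\<^sub>M M) Z < real K" using reals_Archimedean2 by blast
    have iZ: "integrable (M \<Otimes>\<^sub>M M) (\<lambda>z. (real K + C) * indicator Z z)"
      by (intro integrable_mult_right integrable_real_indicator) (auto simp: P.P.emeasure_eq_measure)
    have "(\<integral>z. (real K + C) * indicator Z z - C \<partial>(M \<Otimes>\<^sub>M M)) \<le> integral\<^sup>L (M \<Otimes>\<^sub>M M) (?f K)"
    proof (rule integral_mono[rotated 2])
      fix z assume "z \<in> space (M \<Otimes>\<^sub>M M)"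
      from ge[OF this, of K] show "(real K + C) * indicator Z z - C \<le> ?f K z"
        by (auto simp: indicator_def Z_def truncated_log_0)
    next
      show "integrable (M \<Otimes>\<^sub>M M) (\<lambda>z. (real K + C) * indicator Z z - C)"
        by (intro Bochner_Integration.integrable_diff iZ P.P.integrable_const)
    qed (rule int)
    also have "(\<integral>z. (real K + C) * indicator Z z - C \<partial>(M \<Otimes>\<^sub>M M)) = (real K + C) * measure (M \<Otimes>\<^sub>M M) Z - C"
      by (subst Bochner_Integration.integral_diff[OF iZ P.P.integrable_const]) (simp add: P.P.prob_space)
    finally have "(real K + C) * measure (M \<Otimes>\<^sub>M M) Z \<le> L + C" using le'[of K] by simp
    moreover have "L + C < real K * measure (M \<Otimes>\<^sub>M M) Z" using K pos by (simp add: divide_less_eq)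
    moreover have "0 \<le> C * measure (M \<Otimes>\<^sub>M M) Z" using C0 by simp
    ultimately show False unfolding distrib_right by linarith
  qed
  then have Z0: "measure (M \<Otimes>\<^sub>M M) Z = 0" by (simp add: measure_le_0_iff)
  then have "AE z in M \<Otimes>\<^sub>M M. z \<notin> Z"
    by (subst P.P.prob_eq_0[symmetric]) auto
  then show off: "AE z in M \<Otimes>\<^sub>M M. R (fst z) \<noteq> R (snd z)"
    using AE_space by eventually_elim (auto simp: Z_def)
  have inc: "incseq (\<lambda>K. integral\<^sup>L (M \<Otimes>\<^sub>M M) (?f K))"
    by (intro incseq_SucI integral_mono int truncated_log_mono) simp
  obtain I where I: "(\<lambda>K. integral\<^sup>L (M \<Otimes>\<^sub>M M) (?f K)) \<longlonglongrightarrow> I"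
    using incseq_convergent[OF inc] le' by blast
  have mono: "AE z in M \<Otimes>\<^sub>M M. mono (\<lambda>K. ?f K z)"
    by (intro AE_I2 monoI truncated_log_mono) simp
  have lim: "AE z in M \<Otimes>\<^sub>M M. (\<lambda>K. ?f K z) \<longlonglongrightarrow> - ln \<bar>R (fst z) - R (snd z)\<bar>"
    using off by eventually_elim (simp add: truncated_log_tendsto)
  have meas: "(\<lambda>z. - ln \<bar>R (fst z) - R (snd z)\<bar>) \<in> borel_measurable (M \<Otimes>\<^sub>M M)" by measurable
  have "integrable (M \<Otimes>\<^sub>M M) (\<lambda>z. - ln \<bar>R (fst z) - R (snd z)\<bar>)"
    by (rule integrable_monotone_convergence[OF int mono lim I meas])
  then show "integrable (M \<Otimes>\<^sub>M M) (\<lambda>z. ln \<bar>R (fst z) - R (snd z)\<bar>)" by simp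
  have "integral\<^sup>L (M \<Otimes>\<^sub>M M) (\<lambda>z. - ln \<bar>R (fst z) - R (snd z)\<bar>) = I"
    by (rule integral_monotone_convergence[OF int mono lim I meas])
  moreover have "I \<le> L" using LIMSEQ_le_const2[OF I] le' by blast
  ultimately show "- (\<integral>z. ln \<bar>R (fst z) - R (snd z)\<bar> \<partial>(M \<Otimes>\<^sub>M M)) \<le> L" by simp
qed

text \<open>Lower semicontinuity of the energy along Fekete points \<open>x n\<close> that are images of the points
\<open>y n\<close> under equi-Lipschitz maps. A Skorohod representation turns the weak convergence of the
empirical measures of \<open>y n\<close> into pointwise convergence, and the Lipschitz bound carries it
through the maps. Truncation makes the kernel continuous and bounds the contribution of the
\<open>n\<close> diagonal terms by \<open>K / n\<close>.\<close>

lemma energy_limit: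
  fixes y x :: "nat \<Rightarrow> nat \<Rightarrow> real" and S :: "nat \<Rightarrow> real \<Rightarrow> real"
  assumes y: "\<And>n. quadratic_equilibrium (Suc n) (y n)"
    and r: "strict_mono r"
    and lip: "\<And>k. c-lipschitz_on UNIV (S k)"
    and bd: "\<And>k z. \<bar>S k z\<bar> \<le> B"
    and lim: "\<And>z. (\<lambda>k. S k z) \<longlonglongrightarrow> S' z"
    and S': "continuous_on UNIV S'"
    and val: "\<And>k i. i < Suc (r k) \<Longrightarrow> S k (y (r k) i) = x (r k) i"
    and inj: "\<And>n. inj_on (x n) {..<Suc n}"
    and u: "continuous_on UNIV u"
    and energy: "\<And>n. log_energy u (Suc n) (x n) / (real (Suc n))\<^sup>2 \<le> a n" and a: "a \<longlonglongrightarrow> L"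
  shows "finite_energy u (distr semicircle borel S')" "real_energy u (distr semicircle borel S') \<le> L"
proof -
  interpret real_distribution semicircle by (rule real_distribution_semicircle)
  define \<mu> where "\<mu> = (\<lambda>k. empirical (Suc (r k)) (y (r k)))"
  have \<mu>: "real_distribution (\<mu> k)" for k unfolding \<mu>_def by (rule real_distribution_empirical)
  have [measurable]: "S k \<in> borel_measurable borel" for k
    using lip by (intro borel_measurable_continuous_onI lipschitz_on_continuous_on)
  have [measurable]: "S' \<in> borel_measurable borel" using S' by (rule borel_measurable_continuous_onI)
  have [measurable]: "u \<in> borel_measurable borel" using u by (rule borel_measurable_continuous_onI)
  have weak: "weak_conv_m \<mu> semicircle"
  proof (rule integral_bdd_continuous_conv_imp_weak_conv)
    fix f :: "real \<Rightarrow> real" assume "\<And>x. isCont f x"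
    then have "continuous_on UNIV f" by (simp add: continuous_on_eq_continuous_at)
    from LIMSEQ_subseq_LIMSEQ[OF integral_empirical_tendsto_semicircle[OF this y] r]
    show "(\<lambda>k. integral\<^sup>L (\<mu> k) f) \<longlonglongrightarrow> integral\<^sup>L semicircle f" by (simp add: \<mu>_def o_def)
  qed (auto intro: \<mu> real_distribution_semicircle)
  obtain \<Omega> :: "real measure" and Y Y' where \<Omega>: "prob_space \<Omega>" and [measurable]: "\<And>k. Y k \<in> borel_measurable \<Omega>"
    and DY: "\<And>k. distr \<Omega> borel (Y k) = \<mu> k" and Y': "Y' \<in> measurable \<Omega> lborel" and DY': "distr \<Omega> borel Y' = semicircle"
    and Ylim: "\<And>w. w \<in> space \<Omega> \<Longrightarrow> (\<lambda>k. Y k w) \<longlonglongrightarrow> Y' w"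
    using Skorohod[OF \<mu> real_distribution_semicircle weak] by metis
  have [measurable]: "Y' \<in> borel_measurable \<Omega>" using Y' by simp
  interpret W: prob_space \<Omega> by (rule \<Omega>)
  have c: "c \<ge> 0" using lip lipschitz_on_nonneg by blast
  \<comment> \<open>equi-continuity lets the argument and the map converge at the same time\<close>
  have Xlim: "(\<lambda>k. S k (Y k w)) \<longlonglongrightarrow> S' (Y' w)" if w: "w \<in> space \<Omega>" for w
  proof (rule Lim_transform)
    show "(\<lambda>k. S k (Y' w)) \<longlonglongrightarrow> S' (Y' w)" by (rule lim)
    show "(\<lambda>k. S k (Y k w) - S k (Y' w)) \<longlonglongrightarrow> 0"
    proof (rule Lim_null_comparison)
      show "\<forall>\<^sub>F k in sequentially. norm (S k (Y k w) - S k (Y' w)) \<le> c * dist (Y k w) (Y' w)"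
        using lipschitz_onD[OF lip] by (intro always_eventually) (auto simp: dist_norm)
      show "(\<lambda>k. c * dist (Y k w) (Y' w)) \<longlonglongrightarrow> 0"
        using Ylim[OF w] unfolding tendsto_dist_iff[of "\<lambda>k. Y k w"] by (rule tendsto_mult_right_zero)
    qed
  qed
  have bd': "\<bar>S' z\<bar> \<le> B" for z
    using LIMSEQ_le_const2[OF tendsto_rabs[OF lim[of z]]] bd by blast
  have dbl: "(\<integral>v. \<integral>w. g (h v - h w) \<partial>distr \<Omega> borel X \<partial>distr \<Omega> borel X) = (\<integral>v. \<integral>w. g (h (X v) - h (X w)) \<partial>\<Omega> \<partial>\<Omega>)"
    if [measurable]: "g \<in> borel_measurable borel" "h \<in> borel_measurable borel" "X \<in> borel_measurable \<Omega>" for g h :: "real \<Rightarrow> real" and X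
  proof -
    interpret X: prob_space "distr \<Omega> borel X" by (rule W.prob_space_distr) simp
    have "(\<lambda>v. \<integral>w. g (h v - h w) \<partial>distr \<Omega> borel X) \<in> borel_measurable borel" by measurable
    then show ?thesis by (simp add: integral_distr)
  qed
  have [measurable]: "truncated_log K \<in> borel_measurable borel" for K
    by (rule borel_measurable_continuous_onI[OF continuous_truncated_log])
  define U where "U = (\<integral>s. u (S' s) \<partial>semicircle)"
  have Ulim: "(\<lambda>k. \<integral>s. u (S k s) \<partial>\<mu> k) \<longlonglongrightarrow> U"
  proof -
    have "bounded (u ` {-B..B})"
      by (intro compact_imp_bounded compact_continuous_image continuous_on_subset[OF u]) auto
    then obtain C where C: "\<And>d. d \<in> {-B..B} \<Longrightarrow> \<bar>u d\<bar> \<le> C"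
      unfolding bounded_iff by (metis imageI real_norm_def)
    have uC: "\<bar>u (S k z)\<bar> \<le> C" for k z using bd[of k z] by (intro C) auto
    have "(\<lambda>k. \<integral>w. u (S k (Y k w)) \<partial>\<Omega>) \<longlonglongrightarrow> (\<integral>w. u (S' (Y' w)) \<partial>\<Omega>)"
    proof (rule integral_dominated_convergence[where w = "\<lambda>_. C"])
      show "AE w in \<Omega>. (\<lambda>k. u (S k (Y k w))) \<longlonglongrightarrow> u (S' (Y' w))"
        using u by (intro AE_I2 isCont_tendsto_compose[of _ u] Xlim) (auto simp: continuous_on_eq_continuous_at)
    qed (use uC in auto)
    then show ?thesis unfolding U_def DY[symmetric] DY'[symmetric] by (simp add: integral_distr)
  qed
  have trunc: "(\<integral>v. \<integral>w. truncated_log (real K) (S' v - S' w) \<partial>semicircle \<partial>semicircle) \<le> L - U" for K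
  proof -
    let ?g = "truncated_log (real K)"
    let ?A = "\<lambda>k. \<integral>v. \<integral>w. ?g (S k v - S k w) \<partial>\<mu> k \<partial>\<mu> k"
    have "(\<lambda>k. \<integral>v. \<integral>w. ?g (S k (Y k v) - S k (Y k w)) \<partial>\<Omega> \<partial>\<Omega>) \<longlonglongrightarrow> (\<integral>v. \<integral>w. ?g (S' (Y' v) - S' (Y' w)) \<partial>\<Omega> \<partial>\<Omega>)"
      by (rule double_integral_tendsto[where B = B, OF \<Omega>])
        (use Xlim bd continuous_truncated_log in auto)
    then have A: "?A \<longlonglongrightarrow> (\<integral>v. \<integral>w. ?g (S' v - S' w) \<partial>semicircle \<partial>semicircle)"
      unfolding DY[symmetric] DY'[symmetric] by (simp add: dbl)
    \<comment> \<open>integrals against the empirical measure are averages over the points\<close>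
    have bound: "?A k + (\<integral>s. u (S k s) \<partial>\<mu> k) \<le> a (r k) + real K / real (Suc (r k))" for k
    proof -
      let ?N = "Suc (r k)" and ?x = "x (r k)"
      have meas: "(\<lambda>v. \<integral>w. ?g (S k v - S k w) \<partial>\<mu> k) \<in> borel_measurable borel"
      proof -
        interpret m: real_distribution "\<mu> k" by (rule \<mu>)
        show ?thesis by measurable
      qed
      have inner: "(\<integral>w. ?g (S k v - S k w) \<partial>\<mu> k) = (\<Sum>j<?N. ?g (S k v - S k (y (r k) j))) / real ?N" for v
        unfolding \<mu>_def by (rule integral_empirical) auto
      have "?A k = (\<Sum>i<?N. (\<Sum>j<?N. ?g (S k (y (r k) i) - S k (y (r k) j))) / real ?N) / real ?N"
        using meas unfolding inner unfolding \<mu>_def by (intro integral_empirical) auto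
      also have "\<dots> = (\<Sum>i<?N. \<Sum>j<?N. ?g (?x i - ?x j)) / (real ?N)\<^sup>2"
        using val by (simp add: sum_divide_distrib[symmetric] power2_eq_square)
      also have "(\<Sum>i<?N. \<Sum>j<?N. ?g (?x i - ?x j)) = (\<Sum>i<?N. real K + (\<Sum>j\<in>{..<?N}-{i}. ?g (?x i - ?x j)))"
        by (intro sum.cong refl) (subst sum.remove, auto simp: truncated_log_0)
      also have "\<dots> \<le> (\<Sum>i<?N. real K + (\<Sum>j\<in>{..<?N}-{i}. - ln \<bar>?x i - ?x j\<bar>))"
        using inj[of "r k"] by (intro sum_mono add_left_mono truncated_log_le_neg_ln) (auto simp: inj_on_def)
      also have "\<dots> = real ?N * real K + (\<Sum>i<?N. \<Sum>j\<in>{..<?N}-{i}. - ln \<bar>?x i - ?x j\<bar>)"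
        by (simp only: sum.distrib sum_constant card_lessThan)
      finally have 1: "?A k \<le> (real ?N * real K + (\<Sum>i<?N. \<Sum>j\<in>{..<?N}-{i}. - ln \<bar>?x i - ?x j\<bar>)) / (real ?N)\<^sup>2"
        by (simp add: divide_right_mono)
      have 2: "(\<integral>s. u (S k s) \<partial>\<mu> k) = (\<Sum>i<?N. u (?x i)) / real ?N"
        using val unfolding \<mu>_def by (subst integral_empirical) auto
      have "?A k + (\<integral>s. u (S k s) \<partial>\<mu> k) \<le> log_energy u ?N ?x / (real ?N)\<^sup>2 + real K / real ?N"
        using 1 unfolding 2 log_energy_def by (simp add: add_divide_distrib power2_eq_square del: of_nat_Suc)
      also have "\<dots> \<le> a (r k) + real K / real ?N" using energy by simp
      finally show ?thesis .
    qed
    have "(\<lambda>k. a (r k) + real K / real (Suc (r k))) \<longlonglongrightarrow> L + 0"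
      using LIMSEQ_subseq_LIMSEQ[OF a r] LIMSEQ_subseq_LIMSEQ[OF LIMSEQ_Suc[OF lim_const_over_n[of "real K"]] r]
      by (intro tendsto_add) (simp_all add: o_def)
    from LIMSEQ_le[OF tendsto_add[OF A Ulim] this] bound show ?thesis by force
  qed
  have S'm: "S' \<in> borel_measurable semicircle" by simp
  note tl = truncation_limit[OF prob_space_axioms S'm bd' trunc]
  have "integrable semicircle (\<lambda>s. u (S' s))"
  proof (rule integrable_semicircle)
    show "continuous_on {-2..2} (\<lambda>s. u (S' s))"
      by (rule continuous_on_compose2[OF u continuous_on_subset[OF S']]) auto
  qed simp
  with tl show "finite_energy u (distr semicircle borel S')"
    by (subst finite_energy_distr[OF prob_space_axioms]) auto
  show "real_energy u (distr semicircle borel S') \<le> L"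
    using tl(3) by (subst finite_energy_distr[OF prob_space_axioms]) (auto simp: U_def)
qed

section \<open>Upper bounds for the discrete energy\<close>

text \<open>Two different samples from a product measure are independent.\<close>

lemma distr_PiM_pair:
  assumes "prob_space M" "i \<in> I" "j \<in> I" "i \<noteq> j"
  shows "distr (\<Pi>\<^sub>M k\<in>I. M) (M \<Otimes>\<^sub>M M) (\<lambda>w. (w i, w j)) = M \<Otimes>\<^sub>M M"
proof -
  interpret prob_space M by fact
  let ?f = "\<lambda>b. if b then i else j" and ?P = "\<Pi>\<^sub>M k\<in>I. M"
  have meas: "(\<lambda>w. \<lambda>b\<in>UNIV. w (?f b)) \<in> measurable ?P (\<Pi>\<^sub>M b\<in>UNIV. M)"
    using assms by (intro measurable_restrict measurable_component_singleton) auto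
  have "M \<Otimes>\<^sub>M M = distr (\<Pi>\<^sub>M b\<in>UNIV. case_bool M M b) (M \<Otimes>\<^sub>M M) (\<lambda>w. (w True, w False))"
    by (rule pair_measure_eq_distr_PiM) (rule sigma_finite_measure_axioms)+
  also have "(\<Pi>\<^sub>M b\<in>UNIV. case_bool M M b) = (\<Pi>\<^sub>M b\<in>(UNIV::bool set). M)"
    by (intro PiM_cong refl) (auto split: bool.split)
  also have "\<dots> = distr ?P (\<Pi>\<^sub>M b\<in>UNIV. M) (\<lambda>w. \<lambda>b\<in>UNIV. w (?f b))"
    using assms by (intro distr_PiM_reindex[symmetric]) (auto simp: inj_on_def)
  also have "distr \<dots> (M \<Otimes>\<^sub>M M) (\<lambda>w. (w True, w False)) = distr ?P (M \<Otimes>\<^sub>M M) (\<lambda>w. (w i, w j))"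
    by (subst distr_distr[OF _ meas]) (auto simp: o_def)
  finally show ?thesis by simp
qed

text \<open>Independent samples from a law of finite energy are almost surely distinct, and the expectation of
their discrete energy is explicit. The minimal discrete energy is at most this expectation.\<close>

lemma log_energy_le_sampling:
  fixes T :: "'a \<Rightarrow> real"
  assumes "prob_space M" and [measurable]: "T \<in> borel_measurable M" "u \<in> borel_measurable borel"
    and int: "integrable M (\<lambda>x. u (T x))"
    and off: "AE z in M \<Otimes>\<^sub>M M. T (fst z) \<noteq> T (snd z)"
    and int2: "integrable (M \<Otimes>\<^sub>M M) (\<lambda>z. ln \<bar>T (fst z) - T (snd z)\<bar>)"
    and min: "\<And>z. inj_on z {..<n} \<Longrightarrow> E \<le> log_energy u n z"
  shows "E \<le> (real n)\<^sup>2 * (\<integral>x. u (T x) \<partial>M) - (real n * (real n - 1)) * (\<integral>z. ln \<bar>T (fst z) - T (snd z)\<bar> \<partial>(M \<Otimes>\<^sub>M M))"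
proof -
  interpret prob_space M by fact
  let ?P = "\<Pi>\<^sub>M k\<in>{..<n}. M"
  interpret P: prob_space ?P by (intro prob_space_PiM prob_space_axioms)
  let ?I = "\<integral>z. ln \<bar>T (fst z) - T (snd z)\<bar> \<partial>(M \<Otimes>\<^sub>M M)" and ?U = "\<integral>x. u (T x) \<partial>M"
  have proj: "(\<lambda>w. w i) \<in> measurable ?P M" if "i < n" for i
    using that by (intro measurable_component_singleton) auto
  have pair: "(\<lambda>w. (w i, w j)) \<in> measurable ?P (M \<Otimes>\<^sub>M M)" if "i < n" "j < n" for i j
    using that by (intro measurable_Pair proj)
  have D1: "distr ?P M (\<lambda>w. w i) = M" if "i < n" for i
    using that by (intro distr_PiM_component prob_space_axioms) auto
  have D2: "distr ?P (M \<Otimes>\<^sub>M M) (\<lambda>w. (w i, w j)) = M \<Otimes>\<^sub>M M" if "i < n" "j \<in> {..<n}-{i}" for i j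
    using that by (intro distr_PiM_pair prob_space_axioms) auto
  have L: "integrable ?P (\<lambda>w. ln \<bar>T (w i) - T (w j)\<bar>)" "(\<integral>w. ln \<bar>T (w i) - T (w j)\<bar> \<partial>?P) = ?I"
    "AE w in ?P. T (w i) \<noteq> T (w j)" if ij: "i < n" "j \<in> {..<n}-{i}" for i j
  proof -
    have pm: "(\<lambda>w. (w i, w j)) \<in> measurable ?P (M \<Otimes>\<^sub>M M)" using ij by (intro pair) auto
    have lm: "(\<lambda>z. ln \<bar>T (fst z) - T (snd z)\<bar>) \<in> borel_measurable (M \<Otimes>\<^sub>M M)" by measurable
    show "integrable ?P (\<lambda>w. ln \<bar>T (w i) - T (w j)\<bar>)"
      using integrable_distr_eq[OF pm lm] int2 unfolding D2[OF ij] by simp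
    show "(\<integral>w. ln \<bar>T (w i) - T (w j)\<bar> \<partial>?P) = ?I"
      using integral_distr[OF pm lm] unfolding D2[OF ij] by simp
    have "{z \<in> space (M \<Otimes>\<^sub>M M). T (fst z) \<noteq> T (snd z)} \<in> sets (M \<Otimes>\<^sub>M M)" by measurable
    from AE_distr_iff[OF pm this] off show "AE w in ?P. T (w i) \<noteq> T (w j)" unfolding D2[OF ij] by simp
  qed
  have U: "integrable ?P (\<lambda>w. u (T (w i)))" "(\<integral>w. u (T (w i)) \<partial>?P) = ?U" if i: "i < n" for i
  proof -
    have um: "(\<lambda>x. u (T x)) \<in> borel_measurable M" by measurable
    show "integrable ?P (\<lambda>w. u (T (w i)))"
      using integrable_distr_eq[OF proj[OF i] um] int unfolding D1[OF i] by simp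
    show "(\<integral>w. u (T (w i)) \<partial>?P) = ?U"
      using integral_distr[OF proj[OF i] um] unfolding D1[OF i] by simp
  qed
  have "AE w in ?P. \<forall>i\<in>{..<n}. \<forall>j\<in>{..<n}-{i}. T (w i) \<noteq> T (w j)"
    by (intro AE_finite_allI L) auto
  then have "AE w in ?P. E \<le> log_energy u n (\<lambda>i. T (w i))"
  proof eventually_elim
    case (elim w)
    then have "inj_on (\<lambda>i. T (w i)) {..<n}" unfolding inj_on_def by blast
    then show ?case by (rule min)
  qed
  moreover have "integrable ?P (\<lambda>w. log_energy u n (\<lambda>i. T (w i)))"
    unfolding log_energy_def
    by (intro Bochner_Integration.integrable_add Bochner_Integration.integrable_sum Bochner_Integration.integrable_minus integrable_mult_right L U) auto
  ultimately have "(\<integral>w. E \<partial>?P) \<le> (\<integral>w. log_energy u n (\<lambda>i. T (w i)) \<partial>?P)"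
    by (intro integral_mono_AE) auto
  also have "\<dots> = (\<Sum>i<n. \<Sum>j\<in>{..<n}-{i}. - ?I) + real n * (\<Sum>i<n. ?U)"
  proof -
    have "(\<integral>w. log_energy u n (\<lambda>i. T (w i)) \<partial>?P)
      = (\<integral>w. (\<Sum>i<n. \<Sum>j\<in>{..<n}-{i}. - ln \<bar>T (w i) - T (w j)\<bar>) \<partial>?P) + (\<integral>w. real n * (\<Sum>i<n. u (T (w i))) \<partial>?P)"
      unfolding log_energy_def
      by (intro Bochner_Integration.integral_add Bochner_Integration.integrable_sum Bochner_Integration.integrable_minus integrable_mult_right L U) auto
    also have "(\<integral>w. (\<Sum>i<n. \<Sum>j\<in>{..<n}-{i}. - ln \<bar>T (w i) - T (w j)\<bar>) \<partial>?P)
      = (\<Sum>i<n. \<Sum>j\<in>{..<n}-{i}. \<integral>w. - ln \<bar>T (w i) - T (w j)\<bar> \<partial>?P)"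
    proof (subst Bochner_Integration.integral_sum)
      show "integrable ?P (\<lambda>w. \<Sum>j\<in>{..<n}-{i}. - ln \<bar>T (w i) - T (w j)\<bar>)" if "i \<in> {..<n}" for i
        using that by (intro Bochner_Integration.integrable_sum Bochner_Integration.integrable_minus L) auto
      show "(\<Sum>i<n. \<integral>w. (\<Sum>j\<in>{..<n}-{i}. - ln \<bar>T (w i) - T (w j)\<bar>) \<partial>?P)
        = (\<Sum>i<n. \<Sum>j\<in>{..<n}-{i}. \<integral>w. - ln \<bar>T (w i) - T (w j)\<bar> \<partial>?P)"
        by (intro sum.cong refl Bochner_Integration.integral_sum Bochner_Integration.integrable_minus L) auto
    qed
    also have "\<dots> = (\<Sum>i<n. \<Sum>j\<in>{..<n}-{i}. - ?I)"
      by (intro sum.cong refl) (simp add: L)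
    also have "(\<integral>w. real n * (\<Sum>i<n. u (T (w i))) \<partial>?P) = real n * (\<Sum>i<n. \<integral>w. u (T (w i)) \<partial>?P)"
      by (subst integral_mult_right_zero, subst Bochner_Integration.integral_sum) (auto intro: U)
    also have "(\<Sum>i<n. \<integral>w. u (T (w i)) \<partial>?P) = (\<Sum>i<n. ?U)" by (intro sum.cong refl) (simp add: U)
    finally show ?thesis .
  qed
  also have "\<dots> = (real n)\<^sup>2 * ?U - (real n * (real n - 1)) * ?I"
  proof -
    have "(\<Sum>i<n. \<Sum>j\<in>{..<n}-{i}. - ?I) = (\<Sum>i<n. (real n - 1) * - ?I)"
      by (intro sum.cong refl) (auto simp: of_nat_diff)
    then show ?thesis by (simp add: power2_eq_square algebra_simps)
  qed
  finally show ?thesis by (simp add: P.prob_space)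
qed

text \<open>This is \<open>n ^ n / fact n \<le> exp n\<close>.\<close>

lemma sum_neg_ln_le:
  assumes "n > 0"
  shows "(\<Sum>k\<in>{1..n}. - ln (real k / real n)) \<le> real n"
proof -
  have "real n ^ n /\<^sub>R fact n = (\<Sum>k\<in>{n}. real n ^ k /\<^sub>R fact k)" by simp
  also have "\<dots> \<le> exp (real n)" unfolding exp_def
    by (rule sum_le_suminf[OF summable_exp_generic]) (auto)
  finally have *: "real n ^ n / fact n \<le> exp (real n)" by (simp add: field_simps)
  have "(\<Sum>k\<in>{1..n}. - ln (real k / real n)) = (\<Sum>k\<in>{1..n}. ln (real n) - ln (real k))"
    using assms by (intro sum.cong refl) (simp add: ln_div)
  also have "\<dots> = real n * ln (real n) - (\<Sum>k\<in>{1..n}. ln (real k))" by (simp add: sum_subtractf)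
  also have "(\<Sum>k\<in>{1..m}. ln (real k)) = ln (fact m)" for m
    by (induction m) (simp_all add: ln_mult)
  also have "real n * ln (real n) - ln (fact n) = ln (real n ^ n / fact n)"
    using assms by (simp add: ln_div ln_realpow)
  also have "\<dots> \<le> ln (exp (real n))" using * assms by (subst ln_le_cancel_iff) auto
  finally show ?thesis by simp
qed

text \<open>A configuration that shows the minimal energies to be of order \<open>n\<^sup>2\<close>.\<close>

lemma log_energy_equally_spaced_le:
  assumes "n > 0" and u: "\<And>z. 0 \<le> z \<Longrightarrow> z \<le> 1 \<Longrightarrow> u z \<le> B"
  shows "log_energy u n (\<lambda>i. real i / real n) \<le> (real n)\<^sup>2 * (2 + B)"
proof -
  have part: "(\<Sum>j\<in>J. - ln (real (k j) / real n)) \<le> real n"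
    if "inj_on k J" "k ` J \<subseteq> {1..n}" for k and J :: "nat set"
  proof -
    have "(\<Sum>j\<in>J. - ln (real (k j) / real n)) = (\<Sum>m\<in>k ` J. - ln (real m / real n))"
      by (simp add: sum.reindex[OF that(1)])
    also have "\<dots> \<le> (\<Sum>m\<in>{1..n}. - ln (real m / real n))"
      using that(2) assms(1) by (intro sum_mono2) (auto simp: ln_le_zero_iff)
    also have "\<dots> \<le> real n" by (rule sum_neg_ln_le[OF assms(1)])
    finally show ?thesis .
  qed
  \<comment> \<open>the distances to the left and to the right are distinct multiples of \<open>1 / n\<close>\<close>
  have row: "(\<Sum>j\<in>{..<n}-{i}. - ln \<bar>real i / real n - real j / real n\<bar>) \<le> 2 * real n" if "i < n" for i
  proof -
    have row_eq: "{..<n}-{i} = {..<i} \<union> {i<..<n}" using that by auto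
    have "(\<Sum>j\<in>{..<n}-{i}. - ln \<bar>real i / real n - real j / real n\<bar>)
      =  (\<Sum>j<i. - ln \<bar>real i / real n - real j / real n\<bar>) + (\<Sum>j\<in>{i<..<n}. - ln \<bar>real i / real n - real j / real n\<bar>)"
      unfolding row_eq by (rule sum.union_disjoint) auto
    also have "(\<Sum>j<i. - ln \<bar>real i / real n - real j / real n\<bar>) = (\<Sum>j<i. - ln (real (i - j) / real n))"
      by (intro sum.cong refl) (auto simp: of_nat_diff diff_divide_distrib divide_right_mono)
    also have "\<dots> \<le> real n" using that by (intro part) (auto simp: inj_on_def)
    also have "(\<Sum>j\<in>{i<..<n}. - ln \<bar>real i / real n - real j / real n\<bar>) = (\<Sum>j\<in>{i<..<n}. - ln (real (j - i) / real n))"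
      by (intro sum.cong refl, subst abs_minus_commute) (auto simp: of_nat_diff diff_divide_distrib divide_right_mono)
    also have "\<dots> \<le> real n" using that by (intro part) (auto simp: inj_on_def)
    finally show ?thesis by simp
  qed
  have "(\<Sum>i<n. u (real i / real n)) \<le> (\<Sum>i<n. B)" by (intro sum_mono u) auto
  then have "real n * (\<Sum>i<n. u (real i / real n)) \<le> real n * (real n * B)"
    by (intro mult_left_mono) auto
  moreover have "(\<Sum>i<n. \<Sum>j\<in>{..<n}-{i}. - ln \<bar>real i / real n - real j / real n\<bar>) \<le> (\<Sum>i<n. 2 * real n)"
    using row by (intro sum_mono) auto
  ultimately show ?thesis unfolding log_energy_def by (simp add: power2_eq_square algebra_simps)
qed

section \<open>Displacement convexity\<close>

lemma ln_midpoint_ge: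
  fixes a b :: real assumes "a > 0" "b > 0"
  shows "(ln a + ln b) / 2 \<le> ln ((a + b) / 2)"
proof -
  have "(ln a + ln b) / 2 = ln (sqrt (a * b))" using assms by (simp add: ln_sqrt ln_mult)
  also have "\<dots> \<le> ln ((a + b) / 2)" using assms arith_geo_mean_sqrt[of a b] by (subst ln_le_cancel_iff) auto
  finally show ?thesis .
qed

text \<open>Two maps that order points in the same way satisfy
\<open>\<bar>R s - R t\<bar> = (\<bar>S s - S t\<bar> + \<bar>T s - T t\<bar>) / 2\<close> for their average \<open>R\<close>, so
that convexity of \<open>- ln\<close> applies to the interaction; the potential contributes the
strict gain.\<close>

lemma energy_displacement_convex:
  fixes S T :: "'a \<Rightarrow> real"
  assumes M: "prob_space M" and Sm[measurable]: "S \<in> borel_measurable M" and Tm[measurable]: "T \<in> borel_measurable M"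
    and um[measurable]: "u \<in> borel_measurable borel"
    and eps: "\<epsilon> > 0" and coercive: "\<And>x. 3 * \<bar>x\<bar> - D \<le> u x"
    and mid: "\<And>a b. u ((a + b) / 2) \<le> (u a + u b) / 2 - \<epsilon> / 8 * (a - b)\<^sup>2"
    and S: "finite_energy u (distr M borel S)" and T: "finite_energy u (distr M borel T)"
    and comono: "AE z in M \<Otimes>\<^sub>M M. 0 \<le> (S (fst z) - S (snd z)) * (T (fst z) - T (snd z))"
  shows "finite_energy u (distr M borel (\<lambda>x. (S x + T x) / 2))"
    and "integrable M (\<lambda>x. (S x - T x)\<^sup>2)"
    and "real_energy u (distr M borel (\<lambda>x. (S x + T x) / 2)) \<le>
      (real_energy u (distr M borel S) + real_energy u (distr M borel T)) / 2 - \<epsilon> / 8 * (\<integral>x. (S x - T x)\<^sup>2 \<partial>M)"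
proof -
  interpret prob_space M by fact
  let ?R = "\<lambda>x. (S x + T x) / 2"
  have Rm: "?R \<in> borel_measurable M" by measurable
  note S' = S[unfolded finite_energy_distr(1)[OF M \<open>S \<in> borel_measurable M\<close> \<open>u \<in> borel_measurable borel\<close>]]
  note T' = T[unfolded finite_energy_distr(1)[OF M \<open>T \<in> borel_measurable M\<close> \<open>u \<in> borel_measurable borel\<close>]]
  let ?d = "\<lambda>R z. ln \<bar>R (fst z) - R (snd z)\<bar>"
  have D: "u x \<ge> - D" "\<bar>x\<bar> \<le> \<bar>u x\<bar> + \<bar>D\<bar>" for x using coercive[of x] by auto
  have iuR: "integrable M (\<lambda>x. u (?R x))"
  proof (rule Bochner_Integration.integrable_bound)
    show "integrable M (\<lambda>x. \<bar>u (S x)\<bar> + \<bar>u (T x)\<bar> + \<bar>D\<bar>)" using S' T' by simp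
    show "AE x in M. norm (u (?R x)) \<le> norm (\<bar>u (S x)\<bar> + \<bar>u (T x)\<bar> + \<bar>D\<bar>)"
    proof (rule AE_I2)
      fix x
      have "0 \<le> \<epsilon> / 8 * (S x - T x)\<^sup>2" using eps by simp
      with mid[of "S x" "T x"] have "u (?R x) \<le> (u (S x) + u (T x)) / 2" by linarith
      then have "\<bar>u (?R x)\<bar> \<le> \<bar>u (S x)\<bar> + \<bar>u (T x)\<bar> + \<bar>D\<bar>"
        using D(1)[of "?R x"] by (intro abs_leI) (auto simp: abs_if)
      then show "norm (u (?R x)) \<le> norm (\<bar>u (S x)\<bar> + \<bar>u (T x)\<bar> + \<bar>D\<bar>)"
        unfolding real_norm_def by (rule order_trans[OF _ abs_ge_self])
    qed
  qed measurable
  show isq: "integrable M (\<lambda>x. (S x - T x)\<^sup>2)"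
  proof (rule Bochner_Integration.integrable_bound)
    show "integrable M (\<lambda>x. 8 / \<epsilon> * ((u (S x) + u (T x)) / 2 + \<bar>D\<bar>))" using S' T' by simp
    show "AE x in M. norm ((S x - T x)\<^sup>2) \<le> norm (8 / \<epsilon> * ((u (S x) + u (T x)) / 2 + \<bar>D\<bar>))"
    proof (rule AE_I2)
      fix x
      have "\<epsilon> / 8 * (S x - T x)\<^sup>2 \<le> (u (S x) + u (T x)) / 2 + \<bar>D\<bar>"
        using mid[of "S x" "T x"] D(1)[of "?R x"] by linarith
      then have "(S x - T x)\<^sup>2 \<le> 8 / \<epsilon> * ((u (S x) + u (T x)) / 2 + \<bar>D\<bar>)" using eps by (simp add: field_simps)
      then show "norm ((S x - T x)\<^sup>2) \<le> norm (8 / \<epsilon> * ((u (S x) + u (T x)) / 2 + \<bar>D\<bar>))"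
        unfolding real_norm_def abs_power2 by (rule order_trans[OF _ abs_ge_self])
    qed
  qed measurable
  have iR: "integrable M ?R"
  proof (rule Bochner_Integration.integrable_bound)
    show "integrable M (\<lambda>x. \<bar>u (?R x)\<bar> + \<bar>D\<bar>)" using iuR by simp
    show "AE x in M. norm (?R x) \<le> norm (\<bar>u (?R x)\<bar> + \<bar>D\<bar>)"
      unfolding real_norm_def by (intro AE_I2 order_trans[OF D(2) abs_ge_self])
  qed measurable
  \<comment> \<open>comonotonicity: the absolute values of the two differences add up\<close>
  have key: "AE z in M \<Otimes>\<^sub>M M. ?R (fst z) \<noteq> ?R (snd z) \<and> (?d S z + ?d T z) / 2 \<le> ?d ?R z"
    using S'[THEN conjunct2, THEN conjunct1] T'[THEN conjunct2, THEN conjunct1] comono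
  proof eventually_elim
    case (elim z)
    define a where "a = S (fst z) - S (snd z)"
    define b where "b = T (fst z) - T (snd z)"
    have ab: "a \<noteq> 0" "b \<noteq> 0" "0 \<le> a * b"
      using elim(1) apply (simp add: a_def)
      using elim(2) apply (simp add: b_def)
      using elim(3) apply (simp only: a_def b_def)
      done
    have "(S (fst z) + T (fst z)) / 2 - (S (snd z) + T (snd z)) / 2 = (a + b) / 2"
      unfolding a_def b_def by argo
    moreover have "\<bar>a + b\<bar> = \<bar>a\<bar> + \<bar>b\<bar>"
      using ab(3) unfolding zero_le_mult_iff by linarith
    ultimately have e: "\<bar>?R (fst z) - ?R (snd z)\<bar> = (\<bar>a\<bar> + \<bar>b\<bar>) / 2" by (simp only: abs_divide abs_numeral)
    have "?R (fst z) \<noteq> ?R (snd z)"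
    proof
      assume eq: "?R (fst z) = ?R (snd z)"
      have "\<bar>?R (fst z) - ?R (snd z)\<bar> = 0" unfolding eq by simp
      moreover have "0 < \<bar>a\<bar> + \<bar>b\<bar>" using ab by simp
      ultimately show False unfolding e by simp
    qed
    moreover have "(?d S z + ?d T z) / 2 \<le> ?d ?R z"
      unfolding e a_def[symmetric] b_def[symmetric] using ab by (intro ln_midpoint_ge) auto
    ultimately show ?case by (intro conjI)
  qed
  have dS: "integrable (M \<Otimes>\<^sub>M M) (?d S)" and dT: "integrable (M \<Otimes>\<^sub>M M) (?d T)"
    and uS: "integrable M (\<lambda>x. u (S x))" and uT: "integrable M (\<lambda>x. u (T x))"
    using S' T' by blast+
  have idR: "integrable (M \<Otimes>\<^sub>M M) (?d ?R)"
  proof (rule Bochner_Integration.integrable_bound)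
    show "integrable (M \<Otimes>\<^sub>M M) (\<lambda>z. \<bar>?d S z\<bar> + \<bar>?d T z\<bar> + (\<bar>?R (fst z)\<bar> + \<bar>?R (snd z)\<bar>))"
      by (intro Bochner_Integration.integrable_add integrable_pair_coordinates[OF M integrable_abs[OF iR]] integrable_abs dS dT)
    show "AE z in M \<Otimes>\<^sub>M M. norm (?d ?R z) \<le> norm (\<bar>?d S z\<bar> + \<bar>?d T z\<bar> + (\<bar>?R (fst z)\<bar> + \<bar>?R (snd z)\<bar>))"
      using key
    proof eventually_elim
      case (elim z)
      have bnd: "\<bar>d\<bar> \<le> \<bar>\<bar>p\<bar> + \<bar>q\<bar> + s\<bar>" if "(p + q) / 2 \<le> d" "d \<le> s" "0 \<le> s" for p q d s :: real
      proof -
        have "\<bar>d\<bar> \<le> \<bar>p\<bar> + \<bar>q\<bar> + s"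
        proof (rule abs_leI)
          show "d \<le> \<bar>p\<bar> + \<bar>q\<bar> + s" using that(2) by simp
          have "- d \<le> (- p + - q) / 2" using that(1) by argo
          also have "\<dots> \<le> (\<bar>p\<bar> + \<bar>q\<bar>) / 2" by (intro divide_right_mono add_mono) auto
          also have "\<dots> \<le> \<bar>p\<bar> + \<bar>q\<bar> + s" using that(3) by simp
          finally show "- d \<le> \<bar>p\<bar> + \<bar>q\<bar> + s" .
        qed
        then show ?thesis by (rule order_trans[OF _ abs_ge_self])
      qed
      have "0 \<le> \<bar>?R (fst z)\<bar> + \<bar>?R (snd z)\<bar>" by (intro add_nonneg_nonneg abs_ge_zero)
      from bnd[OF conjunct2[OF elim] ln_le_abs_sum this] show ?case unfolding real_norm_def .
    qed
  qed measurable
  show "finite_energy u (distr M borel ?R)"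
    unfolding finite_energy_distr(1)[OF M Rm \<open>u \<in> borel_measurable borel\<close>]
    by (intro conjI iuR idR) (use key in eventually_elim, rule conjunct1)
  have "(\<integral>z. (?d S z + ?d T z) / 2 \<partial>(M \<Otimes>\<^sub>M M)) \<le> integral\<^sup>L (M \<Otimes>\<^sub>M M) (?d ?R)"
  proof (rule integral_mono_AE)
    show "integrable (M \<Otimes>\<^sub>M M) (\<lambda>z. (?d S z + ?d T z) / 2)" using dS dT by simp
    show "AE z in M \<Otimes>\<^sub>M M. (?d S z + ?d T z) / 2 \<le> ?d ?R z"
      using key by eventually_elim (rule conjunct2)
  qed (rule idR)
  then have 1: "(integral\<^sup>L (M \<Otimes>\<^sub>M M) (?d S) + integral\<^sup>L (M \<Otimes>\<^sub>M M) (?d T)) / 2 \<le> integral\<^sup>L (M \<Otimes>\<^sub>M M) (?d ?R)"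
    using dS dT by simp
  have "(\<integral>x. u (?R x) \<partial>M) \<le> (\<integral>x. (u (S x) + u (T x)) / 2 - \<epsilon> / 8 * (S x - T x)\<^sup>2 \<partial>M)"
    using uS uT isq by (intro integral_mono iuR mid) simp
  also have "\<dots> = ((\<integral>x. u (S x) \<partial>M) + (\<integral>x. u (T x) \<partial>M)) / 2 - \<epsilon> / 8 * (\<integral>x. (S x - T x)\<^sup>2 \<partial>M)"
    using uS uT isq by simp
  finally have 2: "(\<integral>x. u (?R x) \<partial>M) \<le> \<dots>" .
  have combine: "U - I \<le> (U1 - I1 + (U2 - I2)) / 2 - e" if "U \<le> (U1 + U2) / 2 - e" "(I1 + I2) / 2 \<le> I" for U I U1 I1 U2 I2 e :: real
    using that by argo
  show "real_energy u (distr M borel ?R) \<le>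
      (real_energy u (distr M borel S) + real_energy u (distr M borel T)) / 2 - \<epsilon> / 8 * (\<integral>x. (S x - T x)\<^sup>2 \<partial>M)"
    unfolding finite_energy_distr(2)[OF M Rm um] finite_energy_distr(2)[OF M Sm um] finite_energy_distr(2)[OF M Tm um]
    by (rule combine[OF 2 1])
qed

section \<open>The Lipschitz bound\<close>

text \<open>The McShane extension, with the positive part in place of the absolute value so that the
extension is nondecreasing.\<close>

lemma monotone_lipschitz_extension:
  fixes x y :: "'i \<Rightarrow> real"
  assumes I: "finite I" "I \<noteq> {}" and "c \<ge> 0"
    and xy: "\<And>i j. i \<in> I \<Longrightarrow> j \<in> I \<Longrightarrow> x j - x i \<le> c * max 0 (y j - y i)"
  obtains S where "mono S" "c-lipschitz_on UNIV S" "\<And>i. i \<in> I \<Longrightarrow> S (y i) = x i"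
proof
  define S where "S = (\<lambda>z. Min ((\<lambda>i. x i + c * max 0 (z - y i)) ` I))"
  have ge: "w \<le> S z" if "\<And>i. i \<in> I \<Longrightarrow> w \<le> x i + c * max 0 (z - y i)" for w z
    unfolding S_def using I that by (subst Min_ge_iff) auto
  have le: "S z \<le> x i + c * max 0 (z - y i)" if "i \<in> I" for z i
    unfolding S_def using I that by (intro Min_le) auto
  show mono: "mono S"
  proof (rule monoI, rule ge)
    fix a b :: real and i assume "a \<le> b" "i \<in> I"
    have "S a \<le> x i + c * max 0 (a - y i)" using \<open>i \<in> I\<close> by (rule le)
    also have "\<dots> \<le> x i + c * max 0 (b - y i)" using \<open>a \<le> b\<close> \<open>c \<ge> 0\<close> by (intro add_left_mono mult_left_mono) auto
    finally show "S a \<le> x i + c * max 0 (b - y i)" .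
  qed
  have lip: "S b \<le> S a + c * \<bar>b - a\<bar>" for a b
  proof -
    have "S b - c * \<bar>b - a\<bar> \<le> S a"
    proof (rule ge)
      fix i assume "i \<in> I"
      have "S b \<le> x i + c * max 0 (b - y i)" using \<open>i \<in> I\<close> by (rule le)
      also have "c * max 0 (b - y i) \<le> c * (max 0 (a - y i) + \<bar>b - a\<bar>)"
        using \<open>c \<ge> 0\<close> by (intro mult_left_mono) auto
      finally show "S b - c * \<bar>b - a\<bar> \<le> x i + c * max 0 (a - y i)" by (simp add: algebra_simps)
    qed
    then show ?thesis by simp
  qed
  show "c-lipschitz_on UNIV S"
  proof (rule lipschitz_onI)
    fix a b :: real
    show "dist (S a) (S b) \<le> c * dist a b"
      using lip[of a b] lip[of b a] by (auto simp: dist_real_def abs_le_iff abs_minus_commute)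
  qed fact
  show "S (y i) = x i" if i: "i \<in> I" for i
  proof (rule antisym)
    show "S (y i) \<le> x i" using le[OF i, of "y i"] by simp
    show "x i \<le> S (y i)" using xy i by (intro ge) (smt (verit))
  qed
qed

lemma quadratic_equilibrium_exists:
  obtains y where "\<And>i j. i < j \<Longrightarrow> j < Suc n \<Longrightarrow> y i < y j" "quadratic_equilibrium (Suc n) y"
proof -
  let ?q = "\<lambda>x::real. x\<^sup>2 / 2"
  have coercive: "3 * \<bar>x\<bar> - 9 / 2 \<le> ?q x" for x
    using zero_le_power2[of "\<bar>x\<bar> - 3"] by (simp add: power2_eq_square algebra_simps)
  obtain y where y: "\<And>i j. i < j \<Longrightarrow> j < Suc n \<Longrightarrow> y i < y j"
    and min: "\<And>z. inj_on z {..<Suc n} \<Longrightarrow> log_energy ?q (Suc n) y \<le> log_energy ?q (Suc n) z"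
    by (rule log_energy_sorted_minimizer_exists[of ?q "9/2" "Suc n"]) (use coercive in \<open>auto intro!: continuous_intros\<close>)
  have inj: "inj_on y {..<Suc n}"
    by (rule linorder_inj_onI) (use y in \<open>force+\<close>)
  have "real (Suc n) * y i = 2 * (\<Sum>k\<in>{..<Suc n}-{i}. 1 / (y i - y k))" if "i < Suc n" for i
    by (rule log_energy_minimizer_equilibrium[of ?q "\<lambda>x. x", OF _ inj min that]) (auto intro!: derivative_eq_intros)
  then have "quadratic_equilibrium (Suc n) y" by unfold_locales (use inj in auto)
  with y that show ?thesis by blast
qed

text \<open>The interaction forces cancel in total, so the mean of \<open>u' (x i)\<close> is zero. Hence \<open>u'\<close>
is nonpositive at some point and nonnegative at another, and by the growth of \<open>u'\<close> neither
point can be far out on the wrong side of the origin.\<close>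

lemma equilibrium_diameter_bound:
  fixes x :: "nat \<Rightarrow> real"
  assumes eps: "\<epsilon> > 0" and u': "\<And>a b. a \<le> b \<Longrightarrow> \<epsilon> * (b - a) \<le> u' b - u' a"
    and "n > 0"
    and ex: "\<And>i. i < n \<Longrightarrow> real n * u' (x i) = 2 * (\<Sum>k\<in>{..<n}-{i}. 1 / (x i - x k))"
    and diam: "\<And>i j. i < n \<Longrightarrow> j < n \<Longrightarrow> \<bar>x i - x j\<bar> \<le> d"
    and k: "k < n"
  shows "\<bar>x k\<bar> \<le> \<bar>u' 0\<bar> / \<epsilon> + d"
proof -
  let ?s = "\<Sum>i<n. \<Sum>k\<in>{..<n}-{i}. 1 / (x i - x k)"
  have "?s = (\<Sum>i<n. \<Sum>k<n. 1 / (x i - x k))"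
    by (intro sum.cong refl sum.mono_neutral_left) auto
  also have "\<dots> = (\<Sum>k<n. \<Sum>i<n. 1 / (x i - x k))" by (rule sum.swap)
  also have "\<dots> = - (\<Sum>k<n. \<Sum>i<n. 1 / (x k - x i))"
    unfolding sum_negf[symmetric] by (intro sum.cong refl) (metis minus_diff_eq divide_minus_right)
  also have "(\<Sum>k<n. \<Sum>i<n. 1 / (x k - x i)) = ?s"
    by (intro sum.cong refl sum.mono_neutral_right) auto
  finally have "?s = 0" by simp
  moreover have "real n * (\<Sum>i<n. u' (x i)) = 2 * ?s"
    unfolding sum_distrib_left by (intro sum.cong refl) (simp add: ex sum_distrib_left)
  ultimately have sum0: "(\<Sum>i<n. u' (x i)) = 0" using \<open>n > 0\<close> by simp
  have ne: "{..<n} \<noteq> {}" using \<open>n > 0\<close> by auto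
  have "\<exists>i<n. u' (x i) \<le> 0"
  proof (rule ccontr)
    assume "\<not> ?thesis"
    then have "0 < (\<Sum>i<n. u' (x i))" using ne by (intro sum_pos) auto
    with sum0 show False by simp
  qed
  then obtain i where i: "i < n" "u' (x i) \<le> 0" by blast
  have "\<exists>j<n. u' (x j) \<ge> 0"
  proof (rule ccontr)
    assume "\<not> ?thesis"
    then have "0 < (\<Sum>i<n. - u' (x i))" using ne by (intro sum_pos) auto
    with sum0 show False by (simp add: sum_negf)
  qed
  then obtain j where j: "j < n" "u' (x j) \<ge> 0" by blast
  have "x i \<le> \<bar>u' 0\<bar> / \<epsilon>"
  proof (cases "x i \<le> 0")
    case True
    then show ?thesis using eps by (smt (verit) divide_nonneg_pos)
  next
    case False
    then have "x i * \<epsilon> \<le> \<bar>u' 0\<bar>" using u'[of 0 "x i"] i by (simp add: mult.commute)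
    then show ?thesis using eps by (simp add: pos_le_divide_eq)
  qed
  moreover have "- (\<bar>u' 0\<bar> / \<epsilon>) \<le> x j"
  proof (cases "x j \<ge> 0")
    case True
    then show ?thesis using eps by (smt (verit) divide_nonneg_pos)
  next
    case False
    then have "- x j * \<epsilon> \<le> \<bar>u' 0\<bar>" using u'[of "x j" 0] j by (simp add: mult.commute)
    then have "- x j \<le> \<bar>u' 0\<bar> / \<epsilon>" using eps by (simp only: pos_le_divide_eq)
    then show ?thesis by simp
  qed
  ultimately show ?thesis using diam[OF k i(1)] diam[OF k j(1)] by linarith
qed

text \<open>The semicircle density is positive inside \<open>{-2<..<2}\<close>.\<close>

lemma semicircle_AE_eq_imp_eq:
  fixes S T :: "real \<Rightarrow> real"
  assumes S: "continuous_on {-2<..<2} S" and T: "continuous_on {-2<..<2} T"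
    and ae: "AE x in semicircle. S x = T x" and x: "x \<in> {-2<..<2}"
  shows "S x = T x"
proof -
  define V where "V = {-2<..<2} \<inter> (\<lambda>x. S x - T x) -` (- {0})"
  have "open V" unfolding V_def
    by (intro continuous_open_preimage continuous_intros S T)
  have "AE x in lborel. 0 < ennreal (indicator {-2..2} x * (1 / (2 * pi) * sqrt (4 - x\<^sup>2))) \<longrightarrow> S x = T x"
    using ae unfolding semicircle_def by (subst (asm) AE_density) auto
  then have "AE x in lborel. x \<notin> V"
  proof eventually_elim
    case (elim x)
    show ?case
    proof
      assume "x \<in> V"
      then have x: "x \<in> {-2<..<2}" "S x \<noteq> T x" by (auto simp: V_def)
      then have "(2 - x) * (2 + x) > 0" by (intro mult_pos_pos) auto
      then have "4 - x\<^sup>2 > 0" by (simp add: algebra_simps power2_eq_square)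
      with x elim show False by simp
    qed
  qed
  then have "V \<in> null_sets lborel" using \<open>open V\<close> by (subst AE_iff_null_sets) auto
  then have "negligible V" unfolding negligible_iff_null_sets by (rule null_sets_completionI)
  then have "V = {}" using \<open>open V\<close> open_not_negligible by blast
  then show ?thesis using x by (auto simp: V_def)
qed

theorem theorem7:
  fixes u T :: "real \<Rightarrow> real" and \<epsilon> :: real and \<nu> :: "real measure"
  assumes "\<epsilon> > 0"
    and "smooth u"
    and "uniformly_convex \<epsilon> u"
    and "free_gibbs_measure u \<nu>"
    and "brenier_map semicircle \<nu> T"
    and "Ck_on 3 T {-2<..<2}"
  shows "(sqrt (inverse \<epsilon>))-lipschitz_on {-2<..<2} T"
proof -
  interpret real_distribution semicircle by (rule real_distribution_semicircle)
  let ?c = "sqrt (inverse \<epsilon>)"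
  have c: "?c \<ge> 0" using assms(1) by simp
  obtain u' where D: "\<And>x. (u has_real_derivative u' x) (at x)"
    using smooth_has_derivative[OF assms(2)] by blast
  have u': "\<epsilon> * (b - a) \<le> u' b - u' a" if "a \<le> b" for a b
    by (rule uniformly_convex_deriv_mono[OF assms(3) D that])
  obtain C where C: "C \<ge> 0" "\<And>x. 3 * \<bar>x\<bar> - C \<le> u x"
    using uniformly_convex_coercive[OF assms(1,3) D] by blast
  have cont: "continuous_on UNIV u" using D by (intro DERIV_continuous_on) (auto intro: has_field_derivative_at_within)
  then have um[measurable]: "u \<in> borel_measurable borel" by (rule borel_measurable_continuous_onI)
  \<comment> \<open>Fekete points \<open>y n\<close> of \<open>x\<^sup>2 / 2\<close> and \<open>x n\<close> of \<open>u\<close>, with \<open>Suc n\<close> points each\<close>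
  have "\<exists>y. (\<forall>i j. i < j \<longrightarrow> j < Suc n \<longrightarrow> y i < y j) \<and> quadratic_equilibrium (Suc n) y" for n
    using quadratic_equilibrium_exists[of n] by metis
  then obtain y where y: "\<And>n i j. i < j \<Longrightarrow> j < Suc n \<Longrightarrow> y n i < y n j" and yq: "\<And>n. quadratic_equilibrium (Suc n) (y n)"
    by metis
  have "\<exists>x. (\<forall>i j. i < j \<longrightarrow> j < Suc n \<longrightarrow> x i < x j) \<and> (\<forall>z. inj_on z {..<Suc n} \<longrightarrow> log_energy u (Suc n) x \<le> log_energy u (Suc n) z)" for n
    using log_energy_sorted_minimizer_exists[OF cont C(2) C(1), of "Suc n"] by (metis zero_less_Suc)
  then obtain x where x: "\<And>n i j. i < j \<Longrightarrow> j < Suc n \<Longrightarrow> x n i < x n j"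
    and min: "\<And>n z. inj_on z {..<Suc n} \<Longrightarrow> log_energy u (Suc n) (x n) \<le> log_energy u (Suc n) z"
    by metis
  have inj: "inj_on (x n) {..<Suc n}" for n
    by (rule linorder_inj_onI) (use x in \<open>force+\<close>)
  have ex: "real (Suc n) * u' (x n i) = 2 * (\<Sum>k\<in>{..<Suc n}-{i}. 1 / (x n i - x n k))" if "i < Suc n" for n i
    by (rule log_energy_minimizer_equilibrium[OF D inj min that])
  have ey: "real (Suc n) * y n i = 2 * (\<Sum>k\<in>{..<Suc n}-{i}. 1 / (y n i - y n k))" if "i < Suc n" for n i
    using quadratic_equilibrium.equilibrium[OF yq that] .
  have spacing: "x n j - x n i \<le> ?c * (y n j - y n i)" if "i < j" "j < Suc n" for n i j
    by (rule equilibrium_spacing_le[OF assms(1) u' x y ex ey that])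
  have spacing': "x n j - x n i \<le> ?c * max 0 (y n j - y n i)" if "i \<in> {..<Suc n}" "j \<in> {..<Suc n}" for n i j
  proof -
    consider "i < j" | "i = j" | "j < i" by linarith
    then show ?thesis
    proof cases
      case 1
      then show ?thesis using spacing[OF 1, of n] y[OF 1, of n] that by (simp add: max_def)
    next
      case 3
      have "x n j - x n i \<le> 0" using x[OF 3, of n] that by simp
      also have "0 \<le> ?c * max 0 (y n j - y n i)" using c by (intro mult_nonneg_nonneg) auto
      finally show ?thesis .
    qed (use c in simp)
  qed
  have y2: "y n i \<in> {-2..2}" if "i < Suc n" for n i
    using quadratic_equilibrium.abs_position_le_2[OF yq that] by (simp add: abs_le_iff)
  define B where "B = \<bar>u' 0\<bar> / \<epsilon> + ?c * 4"
  have diam: "\<bar>x n i - x n j\<bar> \<le> ?c * 4" if "i < Suc n" "j < Suc n" for n i j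
  proof -
    have "?c * max 0 (y n i - y n j) \<le> ?c * 4" "?c * max 0 (y n j - y n i) \<le> ?c * 4"
      using y2[OF that(1)] y2[OF that(2)] c by (intro mult_left_mono; auto)+
    with spacing'[of i n j] spacing'[of j n i] that show ?thesis by (simp add: abs_le_iff)
  qed
  have xB: "\<bar>x n k\<bar> \<le> B" if "k < Suc n" for n k
    unfolding B_def by (rule equilibrium_diameter_bound[OF assms(1) u' zero_less_Suc ex diam that])
  \<comment> \<open>the values outside \<open>{-2..2}\<close> are irrelevant; clamping makes all bounds global\<close>
  define clamp where "clamp = (\<lambda>z::real. max (-2) (min 2 z))"
  have clamp: "clamp z \<in> {-2..2}" "z \<in> {-2..2} \<Longrightarrow> clamp z = z" "\<bar>clamp z - clamp w\<bar> \<le> \<bar>z - w\<bar>" "z \<le> w \<Longrightarrow> clamp z \<le> clamp w" for z w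
    by (auto simp: clamp_def)
  have "\<exists>S. mono S \<and> ?c-lipschitz_on UNIV S \<and> (\<forall>i<Suc n. S (y n i) = x n i)" for n
    using monotone_lipschitz_extension[of "{..<Suc n}" ?c "x n" "y n"] spacing' c by (metis empty_iff finite_lessThan lessThan_iff zero_less_Suc)
  then obtain E where E: "\<And>n. mono (E n)" "\<And>n. ?c-lipschitz_on UNIV (E n)" "\<And>n i. i < Suc n \<Longrightarrow> E n (y n i) = x n i"
    by metis
  have Elip: "\<bar>E n a - E n b\<bar> \<le> ?c * \<bar>a - b\<bar>" for n a b
    using lipschitz_onD[OF E(2), of a b n] by (simp add: dist_real_def)
  have Ebd: "\<bar>E n z\<bar> \<le> B + ?c * 4" if "z \<in> {-2..2}" for n z
  proof -
    have "\<bar>E n z - E n (y n 0)\<bar> \<le> ?c * \<bar>z - y n 0\<bar>" by (rule Elip)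
    also have "\<dots> \<le> ?c * 4" using that y2[of 0 n] c by (intro mult_left_mono) auto
    finally show ?thesis using E(3)[of 0 n] xB[of 0 n] by simp
  qed
  \<comment> \<open>the maps \<open>E n\<close> from \<open>y n\<close> to \<open>x n\<close> converge along a subsequence\<close>
  obtain g r where r: "strict_mono (r :: nat \<Rightarrow> nat)"
    and conv: "\<And>e. 0 < e \<Longrightarrow> \<exists>N. \<forall>n z. n \<ge> N \<and> z \<in> {-2..2} \<longrightarrow> norm (E (r n) z - g z) < e"
  proof (rule Arzela_Ascoli[of "{-2..2::real}" E "B + ?c * 4"])
    show "\<exists>d. 0 < d \<and> (\<forall>n y. y \<in> {-2..2} \<and> norm (x - y) < d \<longrightarrow> norm (E n x - E n y) < e)"
      if "x \<in> {-2..2}" "0 < e" for x e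
    proof (intro exI[of _ "e / (?c + 1)"] conjI allI impI)
      have c1: "0 < ?c + 1" using c by linarith
      show "0 < e / (?c + 1)" using c1 that by (intro divide_pos_pos)
      fix n y assume "y \<in> {-2..2} \<and> norm (x - y) < e / (?c + 1)"
      then have "(?c + 1) * \<bar>x - y\<bar> < e" using pos_less_divide_eq[OF c1] by (simp add: mult.commute)
      moreover have "?c * \<bar>x - y\<bar> \<le> (?c + 1) * \<bar>x - y\<bar>" by (intro mult_right_mono) auto
      ultimately show "norm (E n x - E n y) < e" using Elip[of n x y] by simp
    qed
  qed (use Ebd in auto)
  define S where "S = (\<lambda>k z. E (r k) (clamp z))"
  define S' where "S' = (\<lambda>z. g (clamp z))"
  have S_lim: "(\<lambda>k. S k z) \<longlonglongrightarrow> S' z" for z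
  proof (rule LIMSEQ_I)
    fix e :: real assume "0 < e"
    from conv[OF this] clamp(1)[of z] show "\<exists>N. \<forall>k\<ge>N. norm (S k z - S' z) < e"
      unfolding S_def S'_def by blast
  qed
  have S_abs: "\<bar>S k a - S k b\<bar> \<le> ?c * \<bar>a - b\<bar>" for k a b
  proof -
    have "\<bar>S k a - S k b\<bar> \<le> ?c * \<bar>clamp a - clamp b\<bar>" unfolding S_def by (rule Elip)
    also have "\<dots> \<le> ?c * \<bar>a - b\<bar>" using c by (intro mult_left_mono clamp)
    finally show ?thesis .
  qed
  have S_lip: "?c-lipschitz_on UNIV (S k)" for k
    using S_abs c by (intro lipschitz_onI) (auto simp: dist_real_def)
  have S'_abs: "\<bar>S' a - S' b\<bar> \<le> ?c * \<bar>a - b\<bar>" for a b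
    by (rule LIMSEQ_le_const2[OF tendsto_rabs[OF tendsto_diff[OF S_lim S_lim]]]) (use S_abs in blast)
  have S'_lip: "?c-lipschitz_on UNIV S'"
    using S'_abs c by (intro lipschitz_onI) (auto simp: dist_real_def)
  have S'_mono: "S' a \<le> S' b" if "a \<le> b" for a b
    by (rule LIMSEQ_le[OF S_lim S_lim]) (use that monoD[OF E(1)] clamp(4) in \<open>auto simp: S_def\<close>)
  have S'_cont: "continuous_on UNIV S'" using S'_lip by (rule lipschitz_on_continuous_on)
  then have S'_meas[measurable]: "S' \<in> borel_measurable borel" by (rule borel_measurable_continuous_onI)
  have val: "S k (y (r k) i) = x (r k) i" if "i < Suc (r k)" for k i
    unfolding S_def using clamp(2)[OF y2[OF that]] E(3)[OF that] by simp
  have S_bd: "\<bar>S k z\<bar> \<le> B + ?c * 4" for k z unfolding S_def by (intro Ebd clamp)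
  have limit: "finite_energy u (distr semicircle borel S')" "real_energy u (distr semicircle borel S') \<le> L"
    if "\<And>n. log_energy u (Suc n) (x n) / (real (Suc n))\<^sup>2 \<le> a n" "a \<longlonglongrightarrow> L" for a L
    by (rule energy_limit(1)[OF yq r S_lip S_bd S_lim S'_cont val inj cont that], assumption)
      (rule energy_limit(2)[OF yq r S_lip S_bd S_lim S'_cont val inj cont that], assumption)

  \<comment> \<open>the limit map \<open>S'\<close> has finite energy, hence so does the minimizer \<open>\<nu>\<close>\<close>
  have "compact (u ` {0..1})" using cont by (intro compact_continuous_image) (auto intro: continuous_on_subset)
  then have "bdd_above (u ` {0..1})" by (intro bounded_imp_bdd_above compact_imp_bounded)
  then obtain b where b: "\<And>z. 0 \<le> z \<Longrightarrow> z \<le> 1 \<Longrightarrow> u z \<le> b"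
    unfolding bdd_above_def by (metis atLeastAtMost_iff imageI)
  have "log_energy u (Suc n) (x n) / (real (Suc n))\<^sup>2 \<le> 2 + b" for n
  proof -
    have "log_energy u (Suc n) (x n) \<le> log_energy u (Suc n) (\<lambda>i. real i / real (Suc n))"
      by (rule min) (auto simp: inj_on_def)
    also have "\<dots> \<le> (real (Suc n))\<^sup>2 * (2 + b)"
      by (rule log_energy_equally_spaced_le[OF zero_less_Suc b])
    finally show ?thesis by (simp add: divide_le_eq mult.commute)
  qed
  from limit(1)[OF this tendsto_const] have feS: "finite_energy u (distr semicircle borel S')" .

  have Tm[measurable]: "T \<in> borel_measurable semicircle" and T\<nu>: "\<nu> = distr semicircle borel T"
    using assms(5) unfolding brenier_map_def by auto
  obtain A where A: "AE x in semicircle. x \<in> A" "mono_on A T"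
    using assms(5) unfolding brenier_map_def by auto
  have minimal: "free_energy u \<nu> \<le> free_energy u (distr semicircle borel R)" if "R \<in> borel_measurable semicircle" for R
    using assms(4) real_distribution_distr[OF that]
    unfolding free_gibbs_measure_def is_arg_min_def by (meson not_le)
  have \<nu>: "real_distribution \<nu>" unfolding T\<nu> by (rule real_distribution_distr[OF Tm])
  have "free_energy u \<nu> \<noteq> \<infinity>"
    using minimal[of S'] unfolding free_energy_eq_real_energy[OF feS] by auto
  then have feT: "finite_energy u (distr semicircle borel T)"
    using finite_energy_if_free_energy_finite(1)[OF \<nu> um C(2)] T\<nu> by simp
  \<comment> \<open>\<open>S'\<close> is minimizing as well\<close>
  let ?U = "\<integral>x. u (T x) \<partial>semicircle" and ?I = "\<integral>z. ln \<bar>T (fst z) - T (snd z)\<bar> \<partial>(semicircle \<Otimes>\<^sub>M semicircle)"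
  have "log_energy u (Suc n) (x n) / (real (Suc n))\<^sup>2 \<le> ?U - (1 - 1 / real (Suc n)) * ?I" for n
  proof -
    have "log_energy u (Suc n) (x n) \<le> (real (Suc n))\<^sup>2 * ?U - (real (Suc n) * (real (Suc n) - 1)) * ?I"
      using feT unfolding finite_energy_distr(1)[OF prob_space_axioms Tm um]
      by (intro log_energy_le_sampling[OF prob_space_axioms Tm um] min) auto
    also have "\<dots> = (?U - (1 - 1 / real (Suc n)) * ?I) * (real (Suc n))\<^sup>2"
      by (simp add: power2_eq_square field_simps del: of_nat_Suc)
    finally show ?thesis by (simp add: divide_le_eq del: of_nat_Suc)
  qed
  moreover have "(\<lambda>n. ?U - (1 - 1 / real (Suc n)) * ?I) \<longlonglongrightarrow> ?U - (1 - 0) * ?I"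
    by (intro tendsto_intros LIMSEQ_Suc[OF lim_const_over_n])
  ultimately have "real_energy u (distr semicircle borel S') \<le> ?U - (1 - 0) * ?I" by (rule limit(2))
  then have le: "real_energy u (distr semicircle borel S') \<le> real_energy u (distr semicircle borel T)"
    by (simp add: finite_energy_distr(2)[OF prob_space_axioms])

  \<comment> \<open>by strict displacement convexity, \<open>S'\<close> and \<open>T\<close> agree almost everywhere\<close>
  have comono: "AE z in semicircle \<Otimes>\<^sub>M semicircle. 0 \<le> (S' (fst z) - S' (snd z)) * (T (fst z) - T (snd z))"
  proof -
    note AE_pair_coordinates[OF prob_space_axioms A(1)]
    then show ?thesis
    proof eventually_elim
      case (elim z)
      then show ?case
        using mono_onD[OF A(2), of "fst z" "snd z"] mono_onD[OF A(2), of "snd z" "fst z"] S'_mono[of "fst z" "snd z"] S'_mono[of "snd z" "fst z"]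
        by (cases "fst z \<le> snd z") (auto simp: zero_le_mult_iff)
    qed
  qed
  have S'm: "S' \<in> borel_measurable semicircle" by simp
  note mid = energy_displacement_convex[OF prob_space_axioms S'm Tm um assms(1) C(2) uniformly_convex_midpoint[OF assms(3)] feS feT comono]
  have "free_energy u \<nu> \<le> free_energy u (distr semicircle borel (\<lambda>x. (S' x + T x) / 2))"
    by (rule minimal) measurable
  then have "real_energy u (distr semicircle borel T) \<le> real_energy u (distr semicircle borel (\<lambda>x. (S' x + T x) / 2))"
    unfolding T\<nu> free_energy_eq_real_energy[OF feT] free_energy_eq_real_energy[OF mid(1)] by simp
  moreover have "e \<le> 0" if "m \<le> (s + t) / 2 - e" "s \<le> t" "t \<le> m" for m s t e :: real
    using that by argo
  ultimately have "\<epsilon> / 8 * (\<integral>x. (S' x - T x)\<^sup>2 \<partial>semicircle) \<le> 0"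
    using mid(3) le by blast
  then have "(\<integral>x. (S' x - T x)\<^sup>2 \<partial>semicircle) \<le> 0" using assms(1) by (simp add: mult_le_0_iff)
  then have "(\<integral>x. (S' x - T x)\<^sup>2 \<partial>semicircle) = 0"
    by (intro antisym integral_nonneg) auto
  then have "AE x in semicircle. (S' x - T x)\<^sup>2 = 0"
    by (subst (asm) integral_nonneg_eq_0_iff_AE[OF mid(2)]) auto
  then have ae: "AE x in semicircle. S' x = T x" by simp
  have T_cont: "continuous_on {-2<..<2} T"
    using assms(6) by (auto simp: numeral_3_eq_3 intro: DERIV_continuous_on)
  have "S' x = T x" if "x \<in> {-2<..<2}" for x
    by (rule semicircle_AE_eq_imp_eq[OF continuous_on_subset[OF S'_cont] T_cont ae that]) simp
  moreover have "?c-lipschitz_on {-2<..<2} S'" by (rule lipschitz_on_subset[OF S'_lip]) simp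
  ultimately show ?thesis by (auto simp: lipschitz_on_def)
qed

end
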